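(* The edge characteristic polynomial $\Phi_\chi^E$, the path characteristic polynomial $\Phi_\chi^P$, the edge matrix polynomial $\Phi_{p_M}^E$ and the path matrix polynomial $\Phi_{p_M}^P$ are invariants of oriented classical and virtual knots and links for every choice of finite quandle $X$, abelian group $A$, finite set $C\subset H^2_Q(X;A)$ of quandle $2$-cocycles (representing quandle cohomology classes), coefficient ring $k$ and set $S\subset\mathrm{Hom}(X,X)$ of quandle endomorphisms. That is, if two diagrams $D,D'$ represent the same oriented classical or virtual knot or link, then each of these four polynomials, determined by the data vector $(X,A,C,k,S)$, takes the same value on $D$ and on $D'$.
   Context: **Quandles.** A quandle is a set $X$ with a binary operation $\triangleright$ such that (i) $x\triangleright x=x$ for all $x$; (ii) for every $y$ the map $x\mapsto x\triangleright y$ is invertible; (iii) $(x\triangleright y)\triangleright z=(x\triangleright z)\triangleright(y\triangleright z)$ for all $x,y,z$. $\mathrm{Hom}(X,X)$ is the set of endomorphisms, i.e. maps $\sigma:X\to X$ with $\sigma(x\triangleright y)=\sigma(x)\triangleright\sigma(y)$. **Diagrams and colorings.** Oriented virtual links are represented by oriented planar diagrams with classical and virtual crossings, up to the classical and virtual Reidemeister moves; classical links are those having diagrams with no virtual crossings, up to the classical moves. The arcs of $D$ run from classical undercrossing to classical undercrossing (passing through overcrossings and virtual crossings unchanged). An $X$-coloring of $D$ assigns an element of $X$ to each arc so that at each classical crossing, if the over-arc is colored $y$ and, with respect to the orientation of the over-arc, the under-arc on its right is colored $x$, then the under-arc on its left is colored $x\triangleright y$. If $\sigma\in\mathrm{Hom}(X,X)$,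 applying $\sigma$ to all colors of an $X$-coloring gives another $X$-coloring. **Coloring vectors.** $C_2^Q(X;\mathbb{Z})$ is the free abelian group on $X\times X$ modulo the subgroup generated by all pairs $(x,x)$. An $X$-coloring $v$ of $D$ determines $\vec v\in C_2^Q(X;\mathbb{Z})$, the sum over classical crossings of $\epsilon\,(x,y)$, where $\epsilon=\pm1$ is the crossing sign, $y$ the color of the over-arc and $x$ the color of the under-arc to the right of the over-arc. An endomorphism $\sigma$ of $X$ induces the linear map $\sigma:C_2^Q(X;\mathbb{Z})\to C_2^Q(X;\mathbb{Z})$ with $\sigma(x,y)=(\sigma(x),\sigma(y))$. **Cocycles.** A quandle $2$-cocycle with values in $A$ is a map $\phi:X\times X\to A$ with $\phi(x,x)=0$ and $\phi(x,z)-\phi(x\triangleright y,z)-\phi(x,y)+\phi(x\triangleright z,y\triangleright z)=0$ for all $x,y,z\in X$. It extends linearly to a homomorphism $C_2^Q(X;\mathbb{Z})\to A$, whose value on $\vec v$ is written $\phi(\vec v)$. $H^2_Q(X;A)$ denotes second quandle cohomology (cocycles modulo coboundaries); the elements of $C$ are cocycles representing classes in it. **Quandle cohomology quiver representation.** Let $k[A]$ be the free $k$-module with basis $A$. For an $X$-coloring $v$ let $V_C(\vec v)\subset k[A]$ be the subspace (submodule) generated by the basis elements $\{\phi(\vec v):\phi\in C\}$. For a coloring $v$, $\sigma\in S$ and $\phi\in C$, let $f_{\sigma,\phi}:k[A]\to k[A]$ be the $k$-linear map sending the basis element $\phi(\vec v)$ to the basis element $\phi(\sigma(\vec v))$ and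 all other basis elements to $0$; set $f_\sigma=\sum_{\phi\in C}f_{\sigma,\phi}$ (this depends on $v$). The quandle cohomology quiver representation $Q$ of $D$ with data vector $(X,A,C,k,S)$ is the directed multigraph whose vertices are the $X$-colorings $v$ of $D$, each weighted by the pair $(k[A],V_C(\vec v))$, with one directed edge from $v$ to $\sigma(v)$ for each vertex $v$ and each $\sigma\in S$, weighted by the map $f_\sigma$ associated to $v$ and $\sigma$. For an edge $e$ of $Q$ write $f_e$ for its weight. **Polynomials of matrices.** Linear maps $k[A]\to k[A]$ are written as matrices $M=(M_{j,l})_{j,l\in A}$ in the basis $A$, where column $l$ is the image of the basis element $l$. The characteristic polynomial is $\chi(M)=\det(tI-M)$. The matrix polynomial is $p_M(x,y)=\sum_{j,l\in A}M_{j,l}\,x^jy^l$, a formal $k$-linear combination of symbols $x^jy^l$ with exponents in $A$; $p_M(f)$ denotes this expression for the matrix of $f$. **The four invariants.** - Edge characteristic polynomial: $\Phi_\chi^E(t)=\sum_{e}\chi(f_e)$, sum over all edges $e$ of $Q$. - Edge matrix polynomial: $\Phi_{p_M}^E(x,y)=\sum_{e}p_M(f_e)$, sum over all edges $e$ of $Q$. - A maximal non-repeating path is a directed path $P_j=e_1e_2\dots e_m$ in $Q$ ($m\ge1$, the target of $e_i$ being the source of $e_{i+1}$) that repeats no edge and is not a proper (contiguous) subpath of any other directed path repeating no edge. Its length is $|j|=m$ and its matrix is the product $M_j=f_{e_m}\cdots f_{e_2}f_{e_1}$. - Path characteristic polynomial: $\Phi_\chi^P=\sum_j\chi(M_j)\,s^{|j|}$,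 sum over all maximal non-repeating paths of $Q$, with $s$ a formal variable. - Path matrix polynomial: $\Phi_{p_M}^P=\sum_j p_M(M_j)\,z^{|j|}$, sum over all maximal non-repeating paths of $Q$, with $z$ a formal variable. *)

theory Defs
  imports
    "HOL-Algebra.Free_Abelian_Groups"
    "HOL-Library.FuncSet"
    "HOL-Library.Sublist"
    "HOL-Library.Countable_Set"
    "HOL-Library.Poly_Mapping"
    "HOL-Computational_Algebra.Polynomial"
    "Graph_Theory.Arc_Walk"
    "Jordan_Normal_Form.Char_Poly"
begin

section \<open>Oriented virtual link diagrams\<close>

text \<open>
  A planar diagram in general position with respect to the height function is cut by horizontal
  lines into slices, each containing exactly one local minimum (Cup), local maximum (Cap) or
  crossing, next to vertical strands. A diagram is the list of these events read from bottom to
  top; the index is the number of strands to the left of the event. Between two events the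
  diagram consists of strands numbered 0, 1, ... from left to right, and the list of their
  directions (True is upwards, False is downwards) is the state at that level. The Boolean of a
  Cup is the direction of its left leg. A planar diagram is determined by such a list up to
  planar isotopy, and every planar diagram is of this form after a planar isotopy.

  In a crossing, the rising strand runs from bottom left to top right and the falling strand
  from top left to bottom right (irrespective of their directions).
\<close>

datatype crossing = Rising_Over | Falling_Over | Virtual

datatype event = Cup nat bool | Cap nat | Cross nat crossing

fun act :: "bool list \<Rightarrow> event \<Rightarrow> bool list option" where
  "act s (Cup i b) =
     (if i \<le> length s then Some (take i s @ [b, \<not> b] @ drop i s) else None)"
| "act s (Cap i) =
     (if Suc i < length s \<and> s ! i \<noteq> s ! Suc i then Some (take i s @ drop (i + 2) s) else None)"
| "act s (Cross i c) =
     (if Suc i < length s then Some (s[i := s ! Suc i, Suc i := s ! i]) else None)"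

fun run :: "bool list \<Rightarrow> event list \<Rightarrow> bool list option" where
  "run s [] = Some s"
| "run s (e # es) = Option.bind (act s e) (\<lambda>s'. run s' es)"

definition virtual_diagram :: "event list \<Rightarrow> bool" where
  "virtual_diagram D \<longleftrightarrow> run [] D = Some []"

definition classical_diagram :: "event list \<Rightarrow> bool" where
  "classical_diagram D \<longleftrightarrow> virtual_diagram D \<and> (\<forall>i. Cross i Virtual \<notin> set D)"

fun pos :: "event \<Rightarrow> nat" where
  "pos (Cup i b) = i" | "pos (Cap i) = i" | "pos (Cross i c) = i"

fun at_pos :: "nat \<Rightarrow> event \<Rightarrow> event" where
  "at_pos j (Cup i b) = Cup j b" | "at_pos j (Cap i) = Cap j" | "at_pos j (Cross i c) = Cross j c"

text \<open>The numbers of strands entering an event from below and leaving it above.\<close>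

fun ins :: "event \<Rightarrow> nat" where
  "ins (Cup i b) = 0" | "ins (Cap i) = 2" | "ins (Cross i c) = 2"

fun outs :: "event \<Rightarrow> nat" where
  "outs (Cup i b) = 2" | "outs (Cap i) = 0" | "outs (Cross i c) = 2"

fun flip :: "crossing \<Rightarrow> crossing" where
  "flip Rising_Over = Falling_Over" | "flip Falling_Over = Rising_Over" | "flip Virtual = Virtual"

text \<open>
  Planar isotopy changes the list of events only in the following ways: the heights of two
  distant events are interchanged, a minimum and a maximum are created or cancelled, or a
  strand is moved across a minimum or maximum of another strand that it crosses.
\<close>

inductive planar_isotopy :: "event list \<Rightarrow> event list \<Rightarrow> bool" where
  exchange: "pos e + outs e \<le> pos f \<Longrightarrow>
    planar_isotopy [e, f] [at_pos (pos f - outs e + ins e) f, e]"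
| zigzag_left: "planar_isotopy [Cup (Suc i) b, Cap i] []"
| zigzag_right: "planar_isotopy [Cup i b, Cap (Suc i)] []"
| slide_cup: "planar_isotopy [Cup i b, Cross (Suc i) c] [Cup (Suc i) b, Cross i (flip c)]"
| slide_cap: "planar_isotopy [Cross i c, Cap (Suc i)] [Cross (Suc i) (flip c), Cap i]"

text \<open>
  The moves below are for unoriented tangles. All orientations are covered, since a move may be
  applied to strands with any directions for which both sides are well-formed.
  In the third move the strands starting at positions i, i+1, i+2 cross pairwise: the first two
  in c1, the outer two in c2 and the last two in c3, the former always being the rising strand.
  The two excluded choices of crossings are those where no strand lies above both others.
\<close>

inductive classical_reidemeister :: "event list \<Rightarrow> event list \<Rightarrow> bool" where
  R1_cup: "c \<noteq> Virtual \<Longrightarrow> classical_reidemeister [Cup i b, Cross i c] [Cup i (\<not> b)]"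
| R1_cap: "c \<noteq> Virtual \<Longrightarrow> classical_reidemeister [Cross i c, Cap i] [Cap i]"
| R2: "c \<noteq> Virtual \<Longrightarrow> classical_reidemeister [Cross i c, Cross i (flip c)] []"
| R3: "Virtual \<notin> {c1, c2, c3} \<Longrightarrow>
    (c1, c2, c3) \<notin> {(Rising_Over, Falling_Over, Rising_Over),
                     (Falling_Over, Rising_Over, Falling_Over)} \<Longrightarrow>
    classical_reidemeister [Cross i c1, Cross (Suc i) c2, Cross i c3]
                           [Cross (Suc i) c3, Cross i c2, Cross (Suc i) c1]"

text \<open>
  The last move comprises the purely virtual third move and the mixed move, in which a strand
  with two virtual crossings passes a classical crossing. The forbidden moves, with exactly one
  virtual crossing, are not included.
\<close>

inductive virtual_reidemeister :: "event list \<Rightarrow> event list \<Rightarrow> bool" where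
  VR1_cup: "virtual_reidemeister [Cup i b, Cross i Virtual] [Cup i (\<not> b)]"
| VR1_cap: "virtual_reidemeister [Cross i Virtual, Cap i] [Cap i]"
| VR2: "virtual_reidemeister [Cross i Virtual, Cross i Virtual] []"
| VR3: "(c1 = Virtual \<and> c2 = Virtual) \<or> (c1 = Virtual \<and> c3 = Virtual) \<or>
        (c2 = Virtual \<and> c3 = Virtual) \<Longrightarrow>
    virtual_reidemeister [Cross i c1, Cross (Suc i) c2, Cross i c3]
                         [Cross (Suc i) c3, Cross i c2, Cross (Suc i) c1]"

definition classical_step :: "event list \<Rightarrow> event list \<Rightarrow> bool" where
  "classical_step D D' \<longleftrightarrow> classical_diagram D \<and> classical_diagram D' \<and>
     (\<exists>u v w w'. D = u @ w @ v \<and> D' = u @ w' @ v \<and>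
        (planar_isotopy w w' \<or> classical_reidemeister w w'))"

definition virtual_step :: "event list \<Rightarrow> event list \<Rightarrow> bool" where
  "virtual_step D D' \<longleftrightarrow> virtual_diagram D \<and> virtual_diagram D' \<and>
     (\<exists>u v w w'. D = u @ w @ v \<and> D' = u @ w' @ v \<and>
        (planar_isotopy w w' \<or> classical_reidemeister w w' \<or> virtual_reidemeister w w'))"

definition same_classical_link :: "event list \<Rightarrow> event list \<Rightarrow> bool" where
  "same_classical_link D D' \<longleftrightarrow>
     classical_diagram D \<and> classical_diagram D' \<and> equivclp classical_step D D'"

definition same_virtual_link :: "event list \<Rightarrow> event list \<Rightarrow> bool" where
  "same_virtual_link D D' \<longleftrightarrow>
     virtual_diagram D \<and> virtual_diagram D' \<and> equivclp virtual_step D D'"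

subsection \<open>Arcs and crossings\<close>

text \<open>
  The point (n, p) is where strand p crosses the horizontal line at level n, directly below
  event n (and directly above event n - 1).
\<close>

type_synonym point = "nat \<times> nat"

definition level :: "event list \<Rightarrow> nat \<Rightarrow> bool list" where
  "level D n = the (run [] (take n D))"

definition points :: "event list \<Rightarrow> point set" where
  "points D = {(n, p). n \<le> length D \<and> p < length (level D n)}"

text \<open>
  Points of one slice that are joined by a piece of the diagram without undercrossing.
\<close>

inductive joined :: "event list \<Rightarrow> point \<Rightarrow> point \<Rightarrow> bool" for D where
  left_of_event: "n < length D \<Longrightarrow> p < pos (D ! n) \<Longrightarrow> joined D (n, p) (Suc n, p)"
| right_of_event: "n < length D \<Longrightarrow>
    joined D (n, pos (D ! n) + ins (D ! n) + q) (Suc n, pos (D ! n) + outs (D ! n) + q)"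
| cup: "n < length D \<Longrightarrow> D ! n = Cup i b \<Longrightarrow> joined D (Suc n, i) (Suc n, Suc i)"
| cap: "n < length D \<Longrightarrow> D ! n = Cap i \<Longrightarrow> joined D (n, i) (n, Suc i)"
| rising: "n < length D \<Longrightarrow> D ! n = Cross i c \<Longrightarrow> c \<noteq> Falling_Over \<Longrightarrow>
    joined D (n, i) (Suc n, Suc i)"
| falling: "n < length D \<Longrightarrow> D ! n = Cross i c \<Longrightarrow> c \<noteq> Rising_Over \<Longrightarrow>
    joined D (n, Suc i) (Suc n, i)"

definition same_arc :: "event list \<Rightarrow> (point \<times> point) set" where
  "same_arc D = {(a, b). a \<in> points D \<and> b \<in> points D \<and> equivclp (joined D) a b}"

type_synonym diagram_arc = "point set"

definition diagram_arcs :: "event list \<Rightarrow> diagram_arc set" where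
  "diagram_arcs D = points D // same_arc D"

definition arc_of :: "event list \<Rightarrow> point \<Rightarrow> diagram_arc" where
  "arc_of D a = same_arc D `` {a}"

definition classical_crossings :: "event list \<Rightarrow> nat set" where
  "classical_crossings D = {n. n < length D \<and> (\<exists>i c. D ! n = Cross i c \<and> c \<noteq> Virtual)}"

text \<open>
  The points adjacent to crossing n on its over-arc, and on its under-arc to the right and to
  the left of the directed over-arc. For instance, if the rising strand is over and directed
  upwards, then its right-hand side is at the bottom right of the crossing.
\<close>

definition over_point :: "event list \<Rightarrow> nat \<Rightarrow> point" where
  "over_point D n = (case D ! n of
     Cross i c \<Rightarrow> (if c = Rising_Over then (n, i) else (n, Suc i)))"

definition right_point :: "event list \<Rightarrow> nat \<Rightarrow> point" where
  "right_point D n = (case D ! n of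
     Cross i c \<Rightarrow>
       (if c = Rising_Over
        then (if level D n ! i then (n, Suc i) else (Suc n, i))
        else (if level D n ! Suc i then (Suc n, Suc i) else (n, i))))"

definition left_point :: "event list \<Rightarrow> nat \<Rightarrow> point" where
  "left_point D n = (case D ! n of
     Cross i c \<Rightarrow>
       (if c = Rising_Over
        then (if level D n ! i then (Suc n, i) else (n, Suc i))
        else (if level D n ! Suc i then (n, i) else (Suc n, Suc i))))"

text \<open>
  A crossing with both strands directed upwards is positive iff the rising strand is over;
  reversing one of the strands changes the sign.
\<close>

definition crossing_sign :: "event list \<Rightarrow> nat \<Rightarrow> int" where
  "crossing_sign D n = (case D ! n of
     Cross i c \<Rightarrow>
       (if (c = Rising_Over) = (level D n ! i = level D n ! Suc i) then 1 else - 1))"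

section \<open>Quandles, cocycles and colorings\<close>

locale quandle =
  fixes X :: "'x set" and tri :: "'x \<Rightarrow> 'x \<Rightarrow> 'x"
  assumes closed: "x \<in> X \<Longrightarrow> y \<in> X \<Longrightarrow> tri x y \<in> X"
    and idem: "x \<in> X \<Longrightarrow> tri x x = x"
    and invertible: "y \<in> X \<Longrightarrow> bij_betw (\<lambda>x. tri x y) X X"
    and self_distrib: "x \<in> X \<Longrightarrow> y \<in> X \<Longrightarrow> z \<in> X \<Longrightarrow>
      tri (tri x y) z = tri (tri x z) (tri y z)"

text \<open>
  Maps on X are functions that are undefined outside X, so that sets of
  maps do not contain the same map more than once.
\<close>

definition quandle_End :: "'x set \<Rightarrow> ('x \<Rightarrow> 'x \<Rightarrow> 'x) \<Rightarrow> ('x \<Rightarrow> 'x) set" where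
  "quandle_End X tri =
     {\<sigma> \<in> X \<rightarrow>\<^sub>E X. \<forall>x\<in>X. \<forall>y\<in>X. \<sigma> (tri x y) = tri (\<sigma> x) (\<sigma> y)}"

definition quandle_cocycles ::
  "'x set \<Rightarrow> ('x \<Rightarrow> 'x \<Rightarrow> 'x) \<Rightarrow> ('x \<times> 'x \<Rightarrow> 'a::ab_group_add) set" where
  "quandle_cocycles X tri =
     {\<phi> \<in> (X \<times> X) \<rightarrow>\<^sub>E UNIV.
        (\<forall>x\<in>X. \<phi> (x, x) = 0) \<and>
        (\<forall>x\<in>X. \<forall>y\<in>X. \<forall>z\<in>X.
           \<phi> (x, z) - \<phi> (tri x y, z) - \<phi> (x, y) + \<phi> (tri x z, tri y z) = 0)}"

definition colorings ::
  "'x set \<Rightarrow> ('x \<Rightarrow> 'x \<Rightarrow> 'x) \<Rightarrow> event list \<Rightarrow> (diagram_arc \<Rightarrow> 'x) set" where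
  "colorings X tri D =
     {v \<in> diagram_arcs D \<rightarrow>\<^sub>E X. \<forall>n\<in>classical_crossings D.
        v (arc_of D (left_point D n)) =
          tri (v (arc_of D (right_point D n))) (v (arc_of D (over_point D n)))}"

definition apply_endo ::
  "event list \<Rightarrow> ('x \<Rightarrow> 'x) \<Rightarrow> (diagram_arc \<Rightarrow> 'x) \<Rightarrow> (diagram_arc \<Rightarrow> 'x)" where
  "apply_endo D \<sigma> v = (\<lambda>a\<in>diagram_arcs D. \<sigma> (v a))"

subsection \<open>Coloring vectors\<close>

text \<open>
  The second quandle chain group is the quotient group free_pairs X Mod degenerate X, whose
  elements are cosets. Homomorphisms on the free group are applied to a coset through its
  representatives, the result being independent of the representative.
\<close>

definition free_pairs :: "'x set \<Rightarrow> ('x \<times> 'x \<Rightarrow>\<^sub>0 int) monoid" where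
  "free_pairs X = free_Abelian_group (X \<times> X)"

definition degenerate :: "'x set \<Rightarrow> ('x \<times> 'x \<Rightarrow>\<^sub>0 int) set" where
  "degenerate X = generate (free_pairs X) ((\<lambda>x. frag_of (x, x)) ` X)"

definition coloring_chain :: "event list \<Rightarrow> (diagram_arc \<Rightarrow> 'x) \<Rightarrow> ('x \<times> 'x \<Rightarrow>\<^sub>0 int)" where
  "coloring_chain D v =
     (\<Sum>n\<in>classical_crossings D. frag_cmul (crossing_sign D n)
        (frag_of (v (arc_of D (right_point D n)), v (arc_of D (over_point D n)))))"

definition coloring_vector ::
  "'x set \<Rightarrow> event list \<Rightarrow> (diagram_arc \<Rightarrow> 'x) \<Rightarrow> ('x \<times> 'x \<Rightarrow>\<^sub>0 int) set" where
  "coloring_vector X D v = degenerate X #>\<^bsub>free_pairs X\<^esub> coloring_chain D v"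

definition endo_chain ::
  "'x set \<Rightarrow> ('x \<Rightarrow> 'x) \<Rightarrow> ('x \<times> 'x \<Rightarrow>\<^sub>0 int) set \<Rightarrow> ('x \<times> 'x \<Rightarrow>\<^sub>0 int) set" where
  "endo_chain X \<sigma> c =
     the_elem ((\<lambda>a. degenerate X #>\<^bsub>free_pairs X\<^esub>
       frag_extend (\<lambda>(x, y). frag_of (\<sigma> x, \<sigma> y)) a) ` c)"

definition int_multiple :: "int \<Rightarrow> 'a::ab_group_add \<Rightarrow> 'a" where
  "int_multiple m a = (if 0 \<le> m then (\<Sum>i<nat m. a) else - (\<Sum>i<nat (- m). a))"

definition linear_ext :: "('p \<Rightarrow> 'a::ab_group_add) \<Rightarrow> ('p \<Rightarrow>\<^sub>0 int) \<Rightarrow> 'a" where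
  "linear_ext \<phi> c = (\<Sum>p\<in>Poly_Mapping.keys c. int_multiple (Poly_Mapping.lookup c p) (\<phi> p))"

definition evaluate ::
  "('x \<times> 'x \<Rightarrow> 'a::ab_group_add) \<Rightarrow> ('x \<times> 'x \<Rightarrow>\<^sub>0 int) set \<Rightarrow> 'a" where
  "evaluate \<phi> c = the_elem (linear_ext \<phi> ` c)"

section \<open>The quandle cohomology quiver representation\<close>

text \<open>
  The free module k[A] is the type of finitely supported functions from A to k. The
  edge (v, s) of the quiver is the one contributed by the vertex v and the endomorphism s.
  The vertex weights of the representation do not enter the invariants.
\<close>

type_synonym ('a, 'k) free_module = "'a \<Rightarrow>\<^sub>0 'k"

type_synonym 'x quiver_edge = "(diagram_arc \<Rightarrow> 'x) \<times> ('x \<Rightarrow> 'x)"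

definition quiver ::
  "'x set \<Rightarrow> ('x \<Rightarrow> 'x \<Rightarrow> 'x) \<Rightarrow> ('x \<Rightarrow> 'x) set \<Rightarrow> event list \<Rightarrow>
     (diagram_arc \<Rightarrow> 'x, 'x quiver_edge) pre_digraph" where
  "quiver X tri S D =
     \<lparr>verts = colorings X tri D,
      arcs = colorings X tri D \<times> S,
      tail = fst,
      head = (\<lambda>(v, \<sigma>). apply_endo D \<sigma> v)\<rparr>"

definition basis_map ::
  "'a \<Rightarrow> 'a \<Rightarrow> ('a, 'k::comm_ring_1) free_module \<Rightarrow> ('a, 'k) free_module" where
  "basis_map a b = (\<lambda>w. Poly_Mapping.single b (Poly_Mapping.lookup w a))"

definition edge_weight ::
  "'x set \<Rightarrow> ('x \<times> 'x \<Rightarrow> 'a::ab_group_add) set \<Rightarrow> event list \<Rightarrow> 'x quiver_edge \<Rightarrow>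
     ('a, 'k::comm_ring_1) free_module \<Rightarrow> ('a, 'k) free_module" where
  "edge_weight X C D = (\<lambda>(v, \<sigma>) w.
     \<Sum>\<phi>\<in>C. basis_map (evaluate \<phi> (coloring_vector X D v))
                   (evaluate \<phi> (endo_chain X \<sigma> (coloring_vector X D v))) w)"

subsection \<open>Matrices and their polynomials\<close>

definition entry ::
  "(('a, 'k::comm_ring_1) free_module \<Rightarrow> ('a, 'k) free_module) \<Rightarrow> 'a \<Rightarrow> 'a \<Rightarrow> 'k" where
  "entry f j l = Poly_Mapping.lookup (f (Poly_Mapping.single l 1)) j"

text \<open>
  The basis A is enumerated by 0, ..., card A - 1 in order to obtain a matrix; the characteristic
  polynomial does not depend on the enumeration. It is meaningful for finite A only, since the
  determinant of an infinite matrix is not defined; for infinite A the value is that of the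
  empty matrix.
\<close>

definition charpoly_of ::
  "(('a, 'k::comm_ring_1) free_module \<Rightarrow> ('a, 'k) free_module) \<Rightarrow> 'k poly" where
  "charpoly_of f =
     (let n = card (UNIV :: 'a set); a = from_nat_into (UNIV :: 'a set)
      in char_poly (Matrix.mat n n (\<lambda>(i, j). entry f (a i) (a j))))"

text \<open>
  A formal linear combination of symbols with exponents in A is a finitely supported
  function on pairs of exponents. Only finitely many terms of the sum are nonzero for the
  maps considered here, even if A is infinite.
\<close>

definition matpoly_of ::
  "(('a, 'k::comm_ring_1) free_module \<Rightarrow> ('a, 'k) free_module) \<Rightarrow> ('a \<times> 'a \<Rightarrow>\<^sub>0 'k)" where
  "matpoly_of f = Sum_any (\<lambda>(j, l). Poly_Mapping.single (j, l) (entry f j l))"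

subsection \<open>Maximal non-repeating paths\<close>

definition nonrepeating_paths :: "('v, 'e) pre_digraph \<Rightarrow> 'e list set" where
  "nonrepeating_paths G = {p. p \<noteq> [] \<and> (\<exists>u w. pre_digraph.trail G u p w)}"

definition maximal_paths :: "('v, 'e) pre_digraph \<Rightarrow> 'e list set" where
  "maximal_paths G =
     {p \<in> nonrepeating_paths G. \<not> (\<exists>q\<in>nonrepeating_paths G. strict_sublist p q)}"

text \<open>The composite in path order: the first edge is applied first.\<close>

definition path_weight ::
  "'x set \<Rightarrow> ('x \<times> 'x \<Rightarrow> 'a::ab_group_add) set \<Rightarrow> event list \<Rightarrow> 'x quiver_edge list \<Rightarrow>
     ('a, 'k::comm_ring_1) free_module \<Rightarrow> ('a, 'k) free_module" where
  "path_weight X C D p = fold (\<lambda>e M. edge_weight X C D e \<circ> M) p id"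

section \<open>The four invariants\<close>

definition edge_characteristic_polynomial ::
  "'x set \<Rightarrow> ('x \<Rightarrow> 'x \<Rightarrow> 'x) \<Rightarrow> ('x \<times> 'x \<Rightarrow> 'a::ab_group_add) set \<Rightarrow> ('x \<Rightarrow> 'x) set \<Rightarrow>
     event list \<Rightarrow> 'k::comm_ring_1 poly" where
  "edge_characteristic_polynomial X tri C S D =
     (\<Sum>e\<in>arcs (quiver X tri S D).
        charpoly_of (edge_weight X C D e :: ('a, 'k) free_module \<Rightarrow> _))"

definition edge_matrix_polynomial ::
  "'x set \<Rightarrow> ('x \<Rightarrow> 'x \<Rightarrow> 'x) \<Rightarrow> ('x \<times> 'x \<Rightarrow> 'a::ab_group_add) set \<Rightarrow> ('x \<Rightarrow> 'x) set \<Rightarrow>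
     event list \<Rightarrow> ('a \<times> 'a \<Rightarrow>\<^sub>0 'k::comm_ring_1)" where
  "edge_matrix_polynomial X tri C S D =
     (\<Sum>e\<in>arcs (quiver X tri S D). matpoly_of (edge_weight X C D e))"

text \<open>In the path polynomials the variable of the outer polynomial is s, respectively z.\<close>

definition path_characteristic_polynomial ::
  "'x set \<Rightarrow> ('x \<Rightarrow> 'x \<Rightarrow> 'x) \<Rightarrow> ('x \<times> 'x \<Rightarrow> 'a::ab_group_add) set \<Rightarrow> ('x \<Rightarrow> 'x) set \<Rightarrow>
     event list \<Rightarrow> 'k::comm_ring_1 poly poly" where
  "path_characteristic_polynomial X tri C S D =
     (\<Sum>p\<in>maximal_paths (quiver X tri S D).
        Polynomial.monom
          (charpoly_of (path_weight X C D p :: ('a, 'k) free_module \<Rightarrow> _)) (length p))"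

definition path_matrix_polynomial ::
  "'x set \<Rightarrow> ('x \<Rightarrow> 'x \<Rightarrow> 'x) \<Rightarrow> ('x \<times> 'x \<Rightarrow> 'a::ab_group_add) set \<Rightarrow> ('x \<Rightarrow> 'x) set \<Rightarrow>
     event list \<Rightarrow> ('a \<times> 'a \<Rightarrow>\<^sub>0 'k::comm_ring_1) poly" where
  "path_matrix_polynomial X tri C S D =
     (\<Sum>p\<in>maximal_paths (quiver X tri S D).
        Polynomial.monom (matpoly_of (path_weight X C D p)) (length p))"

end

theory Submission
  imports Defs
begin

text \<open>
  The quiver and its weights depend on a diagram only through the set of colorings, the action of the
  endomorphisms on it, and the value of every cocycle on every coloring vector. So it suffices to
  find, for each move, a bijection between the colorings of both diagrams that commutes with
  endomorphisms and preserves cocycle values; it then maps edges to edges of the same weight and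
  maximal paths to maximal paths with the same composite.

  A diagram is a word of events, and a coloring amounts to its history: the list of levels between the
  events, each strand carrying its direction and color. Consecutive levels are related by
  \<open>step\<close>, and the value of a cocycle is a sum over the events of a weight that can be
  read off from the level below (lemmas \<open>history_bij\<close> and \<open>weight_history\<close>).
  A move replaces a subword w by w', and two facts about these short words carry the proof. The
  history of such a word is determined by its bottom and top level (\<open>rigid\<close>), and
  wherever both words are well-formed, they connect the same pairs of bottom and top level with the
  same total weight (\<open>transfer\<close>). Hence in every history of the one diagram the part
  belonging to w can be replaced in exactly one way by a history of w' with the same ends. Since
  endomorphisms map histories to histories, uniqueness also makes this replacement commute with them
  (lemma \<open>histories_move\<close>).

  The many oriented versions of a move are treated at once by a signed quandle operation: an
  under-strand changes its color by the operation or by its inverse, depending on the side from which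
  it comes, and the cocycle has a signed version as well. The third Reidemeister move then reduces to
  self-distributivity and the cocycle condition for these signed versions, applied to the bottom, the
  middle and the top strand.
\<close>

section \<open>Signed quandle operations and cocycles\<close>

context quandle
begin

text \<open>
  The color of an under-strand after it has passed below a strand of color y. Its color before is x,
  and p tells that it passes from the right to the left of the over-strand.
\<close>

definition tri_pm :: "bool \<Rightarrow> 'x \<Rightarrow> 'x \<Rightarrow> 'x" where
  "tri_pm p x y = (if p then tri x y else inv_into X (\<lambda>u. tri u y) x)"

lemma tri_pm_True [simp]: "tri_pm True x y = tri x y"
  by (simp add: tri_pm_def)

lemma tri_pm_closed [simp, intro]: "x \<in> X \<Longrightarrow> y \<in> X \<Longrightarrow> tri_pm p x y \<in> X"
  using closed bij_betw_inv_into[OF invertible, of y] by (auto simp: tri_pm_def bij_betw_def)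

lemma tri_pm_cancel: "x \<in> X \<Longrightarrow> y \<in> X \<Longrightarrow> tri_pm (\<not> p) (tri_pm p x y) y = x"
  using bij_betw_inv_into_left[OF invertible, of y x] bij_betw_inv_into_right[OF invertible, of y x]
  by (simp add: tri_pm_def)

lemma tri_pm_cancel' [simp]:
  "x \<in> X \<Longrightarrow> y \<in> X \<Longrightarrow> tri_pm False (tri x y) y = x"
  "x \<in> X \<Longrightarrow> y \<in> X \<Longrightarrow> tri (tri_pm False x y) y = x"
  using tri_pm_cancel[of x y True] tri_pm_cancel[of x y False] by simp_all

lemma tri_pm_eq_iff:
  "x \<in> X \<Longrightarrow> y \<in> X \<Longrightarrow> z \<in> X \<Longrightarrow> tri_pm p x y = z \<longleftrightarrow> x = tri_pm (\<not> p) z y"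
  using tri_pm_cancel[of x y p] tri_pm_cancel[of z y "\<not> p"] by auto

lemma tri_pm_idem [simp]: "x \<in> X \<Longrightarrow> tri_pm p x x = x"
  using idem tri_pm_eq_iff[of x x x p] by (cases p) simp_all

text \<open>
  The inverse operation is preserved because \<open>\<sigma>\<close> can be applied to the equation
  that characterizes it.
\<close>

lemma tri_hom_tri_pm:
  assumes "\<sigma> ` X \<subseteq> X" "\<And>x y. x \<in> X \<Longrightarrow> y \<in> X \<Longrightarrow> \<sigma> (tri x y) = tri (\<sigma> x) (\<sigma> y)"
    and "x \<in> X" "y \<in> X"
  shows "\<sigma> (tri_pm p x y) = tri_pm p (\<sigma> x) (\<sigma> y)"
proof (cases p)
  case False
  have "tri (\<sigma> (tri_pm False x y)) (\<sigma> y) = \<sigma> x"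
    using assms(2)[of "tri_pm False x y" y] assms(3,4) by simp
  moreover have "\<sigma> (tri_pm False x y) \<in> X" "\<sigma> x \<in> X" "\<sigma> y \<in> X" using assms by auto
  ultimately show ?thesis using False tri_pm_cancel'(1)[of "\<sigma> (tri_pm False x y)" "\<sigma> y"] by simp
qed (use assms in simp)

text \<open>
  Acting by z is an automorphism of the quandle, so it preserves the operation and its inverse. The
  same then holds for its inverse.
\<close>

lemma tri_pm_distrib:
  assumes "x \<in> X" "y \<in> X" "z \<in> X"
  shows "tri_pm q (tri_pm p x y) z = tri_pm p (tri_pm q x z) (tri_pm q y z)"
proof -
  have right: "tri (tri_pm p x y) z = tri_pm p (tri x z) (tri y z)"
    if "x \<in> X" "y \<in> X" for x y
  proof (rule tri_hom_tri_pm[where \<sigma> = "\<lambda>u. tri u z"])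
    show "tri (tri u v) z = tri (tri u z) (tri v z)" if "u \<in> X" "v \<in> X" for u v
      using self_distrib[of u v z] that assms by blast
  qed (use assms closed that in auto)
  have "tri (tri_pm p (tri_pm False x z) (tri_pm False y z)) z = tri_pm p x y"
    using assms right by simp
  then have "tri_pm False (tri_pm p x y) z = tri_pm p (tri_pm False x z) (tri_pm False y z)"
    using assms tri_pm_cancel'(1) by (metis tri_pm_closed)
  then show ?thesis using right assms by (cases q) auto
qed

end

locale quandle_cocycle = quandle X tri
  for X :: "'x set" and tri :: "'x \<Rightarrow> 'x \<Rightarrow> 'x" +
  fixes \<phi> :: "'x \<times> 'x \<Rightarrow> 'a::ab_group_add"
  assumes cocycle: "\<phi> \<in> quandle_cocycles X tri"
begin

text \<open>
  The contribution of one passage of the under-strand. A passage from left to right undoes a passage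
  from right to left, so it has the opposite value, taken at the color on the right-hand side.
\<close>

definition cocycle_pm :: "bool \<Rightarrow> 'x \<Rightarrow> 'x \<Rightarrow> 'a" where
  "cocycle_pm p x y = (if p then \<phi> (x, y) else - \<phi> (tri_pm False x y, y))"

lemma cocycle_pm_idem [simp]: "x \<in> X \<Longrightarrow> cocycle_pm p x x = 0"
  using cocycle by (simp add: cocycle_pm_def quandle_cocycles_def)

lemma cocycle_pm_cancel:
  "x \<in> X \<Longrightarrow> y \<in> X \<Longrightarrow> cocycle_pm (\<not> p) (tri_pm p x y) y = - cocycle_pm p x y"
  by (simp add: cocycle_pm_def)

lemma cocycle_pm_cancel' [simp]:
  "x \<in> X \<Longrightarrow> y \<in> X \<Longrightarrow> cocycle_pm False (tri x y) y = - cocycle_pm True x y"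
  "x \<in> X \<Longrightarrow> y \<in> X \<Longrightarrow> cocycle_pm True (tri_pm False x y) y = - cocycle_pm False x y"
  by (simp_all add: cocycle_pm_def)

text \<open>
  Both sides are the contributions of a strand of color x that passes below y and z, in the two
  possible orders; in the second order y has already passed below z. For p and q true this is the
  cocycle condition. The other cases arise from it by renaming the colors on the other side of the
  over-strands.
\<close>

lemma cocycle_pm_distrib:
  assumes "x \<in> X" "y \<in> X" "z \<in> X"
  shows "cocycle_pm p x y + cocycle_pm q (tri_pm p x y) z =
         cocycle_pm q x z + cocycle_pm p (tri_pm q x z) (tri_pm q y z)"
proof -
  have pos: "\<phi> (x, y) + \<phi> (tri x y, z) = \<phi> (x, z) + \<phi> (tri x z, tri y z)"
    if "x \<in> X" "y \<in> X" "z \<in> X" for x y z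
  proof -
    have "\<phi> (x, z) - \<phi> (tri x y, z) - \<phi> (x, y) + \<phi> (tri x z, tri y z) = 0"
      using cocycle that by (simp add: quandle_cocycles_def)
    then have "\<phi> (x, y) + \<phi> (tri x y, z) - (\<phi> (x, z) + \<phi> (tri x z, tri y z)) = 0"
      by (simp add: algebra_simps)
    then show ?thesis by simp
  qed
  have dir: "cocycle_pm p x y + cocycle_pm True (tri_pm p x y) z =
             cocycle_pm True x z + cocycle_pm p (tri x z) (tri y z)"
    if "x \<in> X" "y \<in> X" "z \<in> X" for x y z
  proof (cases p)
    case False
    have "tri_pm False (tri x z) (tri y z) = tri (tri_pm False x y) z"
      using tri_pm_distrib[of x y z True False] that by simp
    then show ?thesis
      using False that pos[of "tri_pm False x y" y z] by (simp add: cocycle_pm_def algebra_simps)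
  qed (use pos that in \<open>simp add: cocycle_pm_def\<close>)
  show ?thesis
  proof (cases q)
    case False
    let ?x = "tri_pm False x z" and ?y = "tri_pm False y z"
    have "tri (tri_pm p ?x ?y) z = tri_pm p x y"
      using tri_pm_distrib[of ?x ?y z True p] assms by simp
    then have "cocycle_pm False (tri_pm p x y) z = - cocycle_pm True (tri_pm p ?x ?y) z"
      using cocycle_pm_cancel'(1)[of "tri_pm p ?x ?y" z] assms by simp
    then show ?thesis using dir[of ?x ?y z] assms False by (simp add: algebra_simps)
  qed (use dir assms in simp)
qed

end

section \<open>Colored levels and histories\<close>

type_synonym 'x strand = "bool \<times> 'x"

definition signed :: "bool \<Rightarrow> 'a \<Rightarrow> 'a::ab_group_add" where
  "signed p a = (if p then a else - a)"

context quandle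
begin

text \<open>
  The strands above a crossing, given those below. The rising strand s ends on the right; it comes
  from the left of an upward falling strand, hence the negation for \<open>Falling_Over\<close>.
\<close>

fun cross :: "crossing \<Rightarrow> 'x strand \<Rightarrow> 'x strand \<Rightarrow> 'x strand list" where
  "cross Rising_Over (p, x) (q, y) = [(q, tri_pm p y x), (p, x)]"
| "cross Falling_Over (p, x) (q, y) = [(q, y), (p, tri_pm (\<not> q) x y)]"
| "cross Virtual (p, x) (q, y) = [(q, y), (p, x)]"

text \<open>
  The relation between the strands entering an event and those leaving it. It is not a function of the
  former, because the color of a new minimum is arbitrary.
\<close>

fun piece :: "event \<Rightarrow> 'x strand list \<Rightarrow> 'x strand list \<Rightarrow> bool" where
  "piece (Cup i b) c c' \<longleftrightarrow> c = [] \<and> (\<exists>a\<in>X. c' = [(b, a), (\<not> b, a)])"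
| "piece (Cap i) c c' \<longleftrightarrow> c' = [] \<and> (\<exists>b a. c = [(b, a), (\<not> b, a)])"
| "piece (Cross i k) c c' \<longleftrightarrow> (\<exists>s t. c = [s, t] \<and> c' = cross k s t)"

definition step :: "event \<Rightarrow> 'x strand list \<Rightarrow> 'x strand list \<Rightarrow> bool" where
  "step e L L' \<longleftrightarrow>
     pos e + ins e \<le> length L \<and> pos e + outs e \<le> length L' \<and>
     take (pos e) L' = take (pos e) L \<and> drop (pos e + outs e) L' = drop (pos e + ins e) L \<and>
     piece e (take (ins e) (drop (pos e) L)) (take (outs e) (drop (pos e) L'))"

text \<open>
  The list H consists of the levels above the events, so the start L is not part of it.
\<close>

fun hist :: "'x strand list \<Rightarrow> event list \<Rightarrow> 'x strand list list \<Rightarrow> bool" where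
  "hist L [] H \<longleftrightarrow> H = []"
| "hist L (e # es) [] \<longleftrightarrow> False"
| "hist L (e # es) (L' # H) \<longleftrightarrow> step e L L' \<and> hist L' es H"

definition final :: "'x strand list \<Rightarrow> 'x strand list list \<Rightarrow> 'x strand list" where
  "final L H = last (L # H)"

definition valid :: "'x strand list \<Rightarrow> bool" where
  "valid L \<longleftrightarrow> snd ` set L \<subseteq> X"

lemma final_simps [simp]: "final L [] = L" "final L (L' # H) = final L' H"
  by (simp_all add: final_def)

lemma valid_simps [simp]:
  "valid []" "valid (s # L) \<longleftrightarrow> snd s \<in> X \<and> valid L" "valid (L @ L') \<longleftrightarrow> valid L \<and> valid L'"
  by (auto simp: valid_def)

lemma final_append: "final L (H @ H') = final (final L H) H'"
  by (induction H arbitrary: L) auto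

lemma hist_length: "hist L w H \<Longrightarrow> length H = length w"
  by (induction L w H rule: hist.induct) auto

lemma hist_append:
  "length H1 = length u \<Longrightarrow>
     hist L (u @ w) (H1 @ H2) \<longleftrightarrow> hist L u H1 \<and> hist (final L H1) w H2"
  by (induction H1 u arbitrary: L rule: list_induct2) auto

lemma hist_appendE:
  assumes "hist L (u @ w) H"
  obtains H1 H2 where "H = H1 @ H2" "hist L u H1" "hist (final L H1) w H2"
proof
  let ?n = "length u"
  show "H = take ?n H @ drop ?n H" by simp
  have "length (take ?n H) = ?n" using hist_length[OF assms] by simp
  with assms hist_append[OF this, of L w "drop ?n H"]
  show "hist L u (take ?n H)" "hist (final L (take ?n H)) w (drop ?n H)" by simp_all
qed

lemma length_cross [simp]: "length (cross k s t) = 2"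
  by (cases "(k, s, t)" rule: cross.cases) auto

lemma valid_cross [simp]: "snd s \<in> X \<Longrightarrow> snd t \<in> X \<Longrightarrow> valid (cross k s t)"
  by (cases "(k, s, t)" rule: cross.cases) auto

lemma fst_cross [simp]: "map fst (cross k s t) = [fst t, fst s]"
  by (cases "(k, s, t)" rule: cross.cases) auto

lemma piece_length: "piece e c c' \<Longrightarrow> length c = ins e \<and> length c' = outs e"
  by (cases e) auto

text \<open>
  Together with the next lemma this turns the definition by positions into one by splitting the level,
  which is the form in which moves are computed.
\<close>

lemma step_append:
  assumes that: "length P = pos e" "length c = ins e"
  shows "step e (P @ c @ Q) L' \<longleftrightarrow> (\<exists>c'. piece e c c' \<and> L' = P @ c' @ Q)"
proof
  assume s: "step e (P @ c @ Q) L'"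
  define c' where "c' = take (outs e) (drop (pos e) L')"
  have "L' = take (pos e) L' @ c' @ drop (pos e + outs e) L'"
    by (metis append_take_drop_id c'_def drop_drop add.commute)
  with s that show "\<exists>c'. piece e c c' \<and> L' = P @ c' @ Q"
    by (auto simp: step_def c'_def)
next
  assume "\<exists>c'. piece e c c' \<and> L' = P @ c' @ Q"
  with that piece_length show "step e (P @ c @ Q) L'"
    by (auto simp: step_def)
qed

lemma step_decomp:
  assumes "step e L L'"
  obtains P c c' Q where "L = P @ c @ Q" "L' = P @ c' @ Q" "piece e c c'"
    "length P = pos e" "length c = ins e" "length c' = outs e"
proof
  let ?P = "take (pos e) L" and ?Q = "drop (pos e + ins e) L"
  let ?c = "take (ins e) (drop (pos e) L)" and ?c' = "take (outs e) (drop (pos e) L')"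
  show "L = ?P @ ?c @ ?Q"
    by (metis append_take_drop_id drop_drop add.commute)
  have "L' = take (pos e) L' @ ?c' @ drop (pos e + outs e) L'"
    by (metis append_take_drop_id drop_drop add.commute)
  then show "L' = ?P @ ?c' @ ?Q" using assms by (simp add: step_def)
  show "piece e ?c ?c'" using assms by (simp add: step_def)
qed (use assms in \<open>auto simp: step_def\<close>)

lemma step_valid: "step e L L' \<Longrightarrow> valid L \<Longrightarrow> valid L'"
  by (erule step_decomp, cases e) auto

lemma step_act: "step e L L' \<Longrightarrow> act (map fst L) e = Some (map fst L')"
proof (erule step_decomp)
  fix P c c' Q
  assume *: "L = P @ c @ Q" "L' = P @ c' @ Q" "piece e c c'" "length P = pos e"
  show "act (map fst L) e = Some (map fst L')"
    using *(1-4) by (cases e) (auto simp: nth_append list_update_append)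
qed

lemma hist_run: "hist L w H \<Longrightarrow> run (map fst L) w = Some (map fst (final L H))"
  by (induction L w H rule: hist.induct) (auto dest: step_act)

lemma hist_valid: "hist L w H \<Longrightarrow> valid L \<Longrightarrow> valid (final L H)"
  by (induction L w H rule: hist.induct) (auto dest: step_valid)

text \<open>Events at the position where a level is split act on the strands next to it.\<close>

lemma step_Cup: "length P = i \<Longrightarrow>
  step (Cup i b) (P @ Q) L' \<longleftrightarrow> (\<exists>a\<in>X. L' = P @ (b, a) # (\<not> b, a) # Q)"
  using step_append[of P "Cup i b" "[]" Q L'] by auto

lemma step_Cap: "length P = i \<Longrightarrow>
  step (Cap i) (P @ s # t # Q) L' \<longleftrightarrow> fst s \<noteq> fst t \<and> snd s = snd t \<and> L' = P @ Q"
  using step_append[of P "Cap i" "[s, t]" Q L'] by (cases s; cases t) auto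

lemma step_Cross: "length P = i \<Longrightarrow>
  step (Cross i k) (P @ s # t # Q) L' \<longleftrightarrow> L' = P @ cross k s t @ Q"
  using step_append[of P "Cross i k" "[s, t]" Q L'] by auto

lemmas step_here =
  step_Cup[OF refl] step_Cap[OF refl] step_Cross[OF refl]

lemma step_next:
  "step (Cup (Suc (length P)) b) (P @ r # Q) L' \<longleftrightarrow>
     (\<exists>a\<in>X. L' = P @ r # (b, a) # (\<not> b, a) # Q)"
  "step (Cap (Suc (length P))) (P @ r # s # t # Q) L' \<longleftrightarrow>
     fst s \<noteq> fst t \<and> snd s = snd t \<and> L' = P @ r # Q"
  "step (Cross (Suc (length P)) k) (P @ r # s # t # Q) L' \<longleftrightarrow>
     L' = P @ r # cross k s t @ Q"
  using step_Cup[of "P @ [r]" "Suc (length P)" b Q L']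
    step_Cap[of "P @ [r]" "Suc (length P)" s t Q L']
    step_Cross[of "P @ [r]" "Suc (length P)" k s t Q L'] by simp_all

lemma step_forward_unique:
  assumes "step e L M" "step e L M'" "\<And>i b. e \<noteq> Cup i b"
  shows "M = M'"
  using assms(1)
proof (rule step_decomp)
  fix P c c' Q
  assume *: "L = P @ c @ Q" "M = P @ c' @ Q" "piece e c c'" "length P = pos e" "length c = ins e"
  then have "\<exists>c''. piece e c c'' \<and> M' = P @ c'' @ Q" using assms(2) step_append by simp
  with * assms(3) show ?thesis by (cases e) auto
qed

lemma cross_inj:
  assumes "cross k s t = cross k s' t'" "snd s \<in> X" "snd t \<in> X" "snd s' \<in> X" "snd t' \<in> X"
  shows "s = s' \<and> t = t'"
proof -
  have inj: "x = x'" if "tri_pm p x y = tri_pm p x' y" "x \<in> X" "x' \<in> X" "y \<in> X" for p x x' y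
    using that tri_pm_cancel by metis
  show ?thesis using assms
    by (cases k; cases s; cases t; cases s'; cases t') (auto dest: inj)
qed

text \<open>
  A strand leaving a crossing determines the one entering it, as right translations are injective.
  Only a maximum loses information.
\<close>

lemma step_backward_unique:
  assumes "step e M L" "step e M' L" "valid M" "valid M'" "\<And>i. e \<noteq> Cap i"
  shows "M = M'"
  using assms(1)
proof (rule step_decomp)
  fix P c c' Q
  assume *: "M = P @ c @ Q" "L = P @ c' @ Q" "piece e c c'"
    "length P = pos e" "length c = ins e" "length c' = outs e"
  from assms(2) show ?thesis
  proof (rule step_decomp)
    fix P2 c2 c2' Q2
    assume **: "M' = P2 @ c2 @ Q2" "L = P2 @ c2' @ Q2" "piece e c2 c2'"
      "length P2 = pos e" "length c2 = ins e" "length c2' = outs e"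
    then have "P = P2" "c' = c2'" "Q = Q2" using * by simp_all
    with * ** assms(3-5) show ?thesis by (cases e) (auto dest!: cross_inj)
  qed
qed

end

section \<open>Both sides of a move determine their histories\<close>

context quandle
begin

text \<open>
  Two distant events e and f taking L to T pass through M if e comes first and through M' if f
  comes first.
\<close>

definition far_apart where
  "far_apart e f L M M' T \<longleftrightarrow> (\<exists>P c c' Q d d' R.
     piece e c c' \<and> piece f d d' \<and> length P = pos e \<and> length P + outs e + length Q = pos f \<and>
     L = P @ c @ Q @ d @ R \<and> M = P @ c' @ Q @ d @ R \<and>
     M' = P @ c @ Q @ d' @ R \<and> T = P @ c' @ Q @ d' @ R)"

lemma far_apartE:
  assumes "far_apart e f L M M' T"
  obtains P c c' Q d d' R where
    "piece e c c'" "piece f d d'" "length P = pos e" "length P + outs e + length Q = pos f"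
    "L = P @ c @ Q @ d @ R" "M = P @ c' @ Q @ d @ R"
    "M' = P @ c @ Q @ d' @ R" "T = P @ c' @ Q @ d' @ R"
  using assms unfolding far_apart_def by blast

lemma append_eq_longer:
  assumes "A @ B = C @ D" "length A \<le> length C"
  obtains E where "C = A @ E" "B = E @ D"
  using assms by (auto simp: append_eq_append_conv2)

lemma piece_at_pos: "piece (at_pos j e) c c' \<longleftrightarrow> piece e c c'"
  by (cases e) auto

lemma at_pos_simps [simp]:
  "pos (at_pos j e) = j" "ins (at_pos j e) = ins e" "outs (at_pos j e) = outs e"
  by (cases e; simp)+

lemma far_apart_steps:
  assumes "far_apart e f L M M' T"
  shows "step e L M \<and> step f M T \<and> step (at_pos (pos f - outs e + ins e) f) L M' \<and> step e M' T"
  using assms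
proof (rule far_apartE)
  fix P c c' Q d d' R
  assume *: "piece e c c'" "piece f d d'" "length P = pos e" "length P + outs e + length Q = pos f"
    "L = P @ c @ Q @ d @ R" "M = P @ c' @ Q @ d @ R"
    "M' = P @ c @ Q @ d' @ R" "T = P @ c' @ Q @ d' @ R"
  let ?f = "at_pos (pos f - outs e + ins e) f"
  have len: "length c = ins e" "length c' = outs e" "length d = ins f"
    using * piece_length by auto
  have "step e L M" "step e M' T"
    using * len step_append[of P e c] by auto
  moreover have "step f M T"
    using * len step_append[of "P @ c' @ Q" f d] by auto
  moreover have "step ?f L M'"
    using * len step_append[of "P @ c @ Q" ?f d] by (auto simp: piece_at_pos)
  ultimately show "step e L M \<and> step f M T \<and> step ?f L M' \<and> step e M' T" by blast
qed

lemma far_apart_forward: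
  assumes "pos e + outs e \<le> pos f" "step e L M" "step f M T"
  shows "\<exists>M'. far_apart e f L M M' T"
  using assms(2)
proof (rule step_decomp)
  fix P c c' Q0
  assume 1: "L = P @ c @ Q0" "M = P @ c' @ Q0" "piece e c c'"
    "length P = pos e" "length c = ins e" "length c' = outs e"
  from assms(3) show ?thesis
  proof (rule step_decomp)
    fix P2 d d' R
    assume 2: "M = P2 @ d @ R" "T = P2 @ d' @ R" "piece f d d'"
      "length P2 = pos f" "length d = ins f" "length d' = outs f"
    have "(P @ c') @ Q0 = P2 @ d @ R" "length (P @ c') \<le> length P2"
      using 1(2,4,6) 2(1,4) assms(1) by simp_all
    then obtain Q where Q: "P2 = (P @ c') @ Q" "Q0 = Q @ d @ R" by (rule append_eq_longer)
    have "length P + outs e + length Q = pos f" "L = P @ c @ Q @ d @ R" "M = P @ c' @ Q @ d @ R"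
      "T = P @ c' @ Q @ d' @ R"
      using 1(1,2,4,6) 2(2,4) Q by simp_all
    with 1(3,4) 2(3) show ?thesis unfolding far_apart_def by blast
  qed
qed

lemma far_apart_backward:
  assumes "pos e + outs e \<le> pos f"
    and "step (at_pos (pos f - outs e + ins e) f) L M'" "step e M' T"
  shows "\<exists>M. far_apart e f L M M' T"
  using assms(2)
proof (rule step_decomp)
  fix P2 d d' R
  assume 1: "L = P2 @ d @ R" "M' = P2 @ d' @ R" "piece (at_pos (pos f - outs e + ins e) f) d d'"
    "length P2 = pos (at_pos (pos f - outs e + ins e) f)"
  from assms(3) show ?thesis
  proof (rule step_decomp)
    fix P c c' Q0
    assume 2: "M' = P @ c @ Q0" "T = P @ c' @ Q0" "piece e c c'"
      "length P = pos e" "length c = ins e" "length c' = outs e"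
    have "(P @ c) @ Q0 = P2 @ d' @ R" "length (P @ c) \<le> length P2"
      using 1(2,4) 2(1,4,5) assms(1) by simp_all
    then obtain Q where Q: "P2 = (P @ c) @ Q" "Q0 = Q @ d' @ R" by (rule append_eq_longer)
    have "length P + outs e + length Q = pos f" "L = P @ c @ Q @ d @ R" "M' = P @ c @ Q @ d' @ R"
      "T = P @ c' @ Q @ d' @ R"
      using 1(1,2,4) 2(2,4,5) Q assms(1) by simp_all
    with 1(3) 2(3,4) show ?thesis unfolding far_apart_def piece_at_pos by blast
  qed
qed

text \<open>
  The history of the word is determined by its bottom and top level. It makes the replacement of one
  side of a move by the other unique.
\<close>

definition rigid :: "event list \<Rightarrow> bool" where
  "rigid w \<longleftrightarrow> (\<forall>L H H'. valid L \<longrightarrow> hist L w H \<longrightarrow> hist L w H' \<longrightarrow>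
     final L H = final L H' \<longrightarrow> H = H')"

lemma hist_Cons: "hist L (e # w) H \<longleftrightarrow> (\<exists>M H'. H = M # H' \<and> step e L M \<and> hist M w H')"
  by (cases H) auto

lemma rigid_short: "rigid []" "rigid [e]"
  by (auto simp: rigid_def hist_Cons)

lemma rigid_pair:
  assumes "\<And>L M M' T. valid L \<Longrightarrow> step e L M \<Longrightarrow> step f M T \<Longrightarrow> step e L M' \<Longrightarrow>
     step f M' T \<Longrightarrow> M = M'"
  shows "rigid [e, f]"
  unfolding rigid_def
proof (intro allI impI)
  fix L H H'
  assume *: "valid L" "hist L [e, f] H" "hist L [e, f] H'" "final L H = final L H'"
  obtain M T where H: "H = [M, T]" "step e L M" "step f M T"
    using *(2) by (auto simp: hist_Cons)
  obtain M' T' where H': "H' = [M', T']" "step e L M'" "step f M' T'"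
    using *(3) by (auto simp: hist_Cons)
  show "H = H'" using assms[of L M T M'] * H H' by simp
qed

lemma hist_unique_no_Cup:
  "hist L w H \<Longrightarrow> hist L w H' \<Longrightarrow> \<forall>i b. Cup i b \<notin> set w \<Longrightarrow> H = H'"
proof (induction w arbitrary: L H H')
  case (Cons e w)
  obtain M G M' G' where *: "H = M # G" "step e L M" "hist M w G"
    "H' = M' # G'" "step e L M'" "hist M' w G'"
    using Cons.prems(1,2) unfolding hist_Cons by blast
  have "M = M'" by (rule step_forward_unique[OF *(2,5)]) (use Cons.prems(3) in auto)
  then show ?case using Cons.IH[of M G G'] * Cons.prems(3) by simp
qed auto

lemma rigid_no_Cup: "\<forall>i b. Cup i b \<notin> set w \<Longrightarrow> rigid w"
  using hist_unique_no_Cup unfolding rigid_def by blast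

text \<open>
  A crossing can be read backwards, so the level between the two events is determined by the top.
\<close>

lemma rigid_Cross: "rigid [e, Cross i k]"
  by (rule rigid_pair) (metis step_backward_unique step_valid event.distinct(5))

text \<open>
  The two events may both be minima, so that neither reading direction determines the intermediate
  level. It consists of a part of the top level, where one event has happened already, and a part of
  the bottom level.
\<close>

lemma rigid_exchange:
  assumes "pos e + outs e \<le> pos f"
  shows "rigid [e, f]" "rigid [at_pos (pos f - outs e + ins e) f, e]"
proof -
  have *: "M = take (pos e + outs e) T @ drop (pos e + ins e) L \<and>
      M' = take (pos e + ins e) L @ drop (pos e + outs e) T"
    if "far_apart e f L M M' T" for L M M' T
    using that
  proof (rule far_apartE)
    fix P c c' Q d d' R
    assume "piece e c c'" "length P = pos e"
      "L = P @ c @ Q @ d @ R" "M = P @ c' @ Q @ d @ R"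
      "M' = P @ c @ Q @ d' @ R" "T = P @ c' @ Q @ d' @ R"
    with piece_length[of e c c'] show ?thesis by simp
  qed
  show "rigid [e, f]"
    by (rule rigid_pair) (metis far_apart_forward[OF assms] *)
  show "rigid [at_pos (pos f - outs e + ins e) f, e]"
    by (rule rigid_pair) (metis far_apart_backward[OF assms] *)
qed

text \<open>
  The maximum joins the minimum to a neighboring strand, whose color the minimum must therefore have.
\<close>

lemma rigid_zigzag:
  "rigid [Cup (Suc i) b, Cap i]" "rigid [Cup i b, Cap (Suc i)]"
proof -
  have "M = M'" if s: "step (Cup (Suc i) b) L M" "step (Cap i) M T" "step (Cup (Suc i) b) L M'"
    "step (Cap i) M' T" for L M M' T
  proof -
    have "Suc i \<le> length L" using s(1) by (simp add: step_def)
    then have "L = take i L @ L ! i # drop (Suc i) L" "length (take i L) = i"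
      by (simp_all add: id_take_nth_drop)
    then obtain P r Q where L: "L = P @ r # Q" "i = length P" by metis
    show ?thesis using s by (auto simp: L step_here step_next)
  qed
  then show "rigid [Cup (Suc i) b, Cap i]" by (intro rigid_pair)
  have "M = M'" if s: "step (Cup i b) L M" "step (Cap (Suc i)) M T" "step (Cup i b) L M'"
    "step (Cap (Suc i)) M' T" for L M M' T
  proof -
    have "length M = Suc (Suc (length L))" "i \<le> length L"
      using s(1) by (auto elim!: step_decomp)
    moreover have "Suc (Suc i) < length M" using s(2) by (auto elim!: step_decomp)
    ultimately have "i < length L" by simp
    then have "L = take i L @ L ! i # drop (Suc i) L" "length (take i L) = i"
      by (simp_all add: id_take_nth_drop)
    then obtain P r Q where L: "L = P @ r # Q" "i = length P" by metis
    show ?thesis using s by (auto simp: L step_here step_next)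
  qed
  then show "rigid [Cup i b, Cap (Suc i)]" by (intro rigid_pair)
qed

lemma rigid_planar_isotopy: "planar_isotopy w w' \<Longrightarrow> rigid w \<and> rigid w'"
proof (erule planar_isotopy.cases)
  fix e f
  assume "w = [e, f]" "w' = [at_pos (pos f - outs e + ins e) f, e]" "pos e + outs e \<le> pos f"
  then show "rigid w \<and> rigid w'" using rigid_exchange by blast
qed (auto simp: rigid_zigzag rigid_short rigid_Cross intro: rigid_no_Cup)

lemma rigid_reidemeister:
  "classical_reidemeister w w' \<or> virtual_reidemeister w w' \<Longrightarrow> rigid w \<and> rigid w'"
  by (auto elim!: classical_reidemeister.cases virtual_reidemeister.cases
      simp: rigid_short rigid_Cross intro: rigid_no_Cup)

end

section \<open>Both sides of a move have the same effect\<close>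

context quandle_cocycle
begin

text \<open>
  The crossing sign depends on the directions of both strands. The direction of the over-strand is
  already accounted for in the signed cocycle, which leaves the direction of the under-strand as the
  sign.
\<close>

fun cross_weight :: "crossing \<Rightarrow> 'x strand \<Rightarrow> 'x strand \<Rightarrow> 'a" where
  "cross_weight Rising_Over (p, x) (q, y) = signed q (cocycle_pm p y x)"
| "cross_weight Falling_Over (p, x) (q, y) = signed p (cocycle_pm (\<not> q) x y)"
| "cross_weight Virtual s t = 0"

fun step_weight :: "event \<Rightarrow> 'x strand list \<Rightarrow> 'a" where
  "step_weight (Cross i k) L = cross_weight k (L ! i) (L ! Suc i)"
| "step_weight e L = 0"

fun weight :: "'x strand list \<Rightarrow> event list \<Rightarrow> 'x strand list list \<Rightarrow> 'a" where
  "weight L (e # es) (L' # H) = step_weight e L + weight L' es H"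
| "weight L es H = 0"

text \<open>
  All that the rest of a diagram can notice of a word: the pairs of a bottom level L and a top level T
  that it connects, and the weight m with which it does so.
\<close>

definition transfer :: "event list \<Rightarrow> 'x strand list \<Rightarrow> 'x strand list \<Rightarrow> 'a \<Rightarrow> bool" where
  "transfer w L T m \<longleftrightarrow> (\<exists>H. hist L w H \<and> final L H = T \<and> weight L w H = m)"

lemma transfer_Nil [simp]: "transfer [] L T m \<longleftrightarrow> T = L \<and> m = 0"
  by (auto simp: transfer_def)

text \<open>
  The weight is subtracted on the right, so that unfolding a word leaves a closed expression for its
  weight.
\<close>

lemma transfer_Cons:
  "transfer (e # w) L T m \<longleftrightarrow> (\<exists>L'. step e L L' \<and> transfer w L' T (m - step_weight e L))"
proof -
  have ex_list: "(\<exists>H. R H) \<longleftrightarrow> R [] \<or> (\<exists>L' H'. R (L' # H'))" for R :: "'x strand list list \<Rightarrow> bool"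
    by (metis list.exhaust)
  have "step_weight e L + m' = m \<longleftrightarrow> m' = m - step_weight e L" for m'
    by (auto simp: algebra_simps)
  then show ?thesis
    unfolding transfer_def ex_list[of "\<lambda>H. hist L (e # w) H \<and> _ H"]
    by (simp del: split_paired_Ex)
qed

lemma nth_after [simp]:
  "(P @ l) ! Suc (length P) = l ! 1" "(P @ l) ! Suc (Suc (length P)) = l ! 2"
  by (simp_all add: nth_append)

lemma transfer_here [simp]:
  "transfer (Cup (length P) b # w) (P @ Q) T m \<longleftrightarrow>
     (\<exists>a\<in>X. transfer w (P @ (b, a) # (\<not> b, a) # Q) T m)"
  "transfer (Cap (length P) # w) (P @ s # t # Q) T m \<longleftrightarrow>
     fst s \<noteq> fst t \<and> snd s = snd t \<and> transfer w (P @ Q) T m"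
  "transfer (Cross (length P) k # w) (P @ s # t # Q) T m \<longleftrightarrow>
     transfer w (P @ cross k s t @ Q) T (m - cross_weight k s t)"
  by (auto simp: transfer_Cons step_here)

lemma transfer_next [simp]:
  "transfer (Cup (Suc (length P)) b # w) (P @ r # Q) T m \<longleftrightarrow>
     (\<exists>a\<in>X. transfer w (P @ r # (b, a) # (\<not> b, a) # Q) T m)"
  "transfer (Cap (Suc (length P)) # w) (P @ r # s # t # Q) T m \<longleftrightarrow>
     fst s \<noteq> fst t \<and> snd s = snd t \<and> transfer w (P @ r # Q) T m"
  "transfer (Cross (Suc (length P)) k # w) (P @ r # s # t # Q) T m \<longleftrightarrow>
     transfer w (P @ r # cross k s t @ Q) T (m - cross_weight k s t)"
  using transfer_here[where P = "P @ [r]"] by simp_all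

lemma level_split:
  assumes "i \<le> length L"
  obtains P Q where "L = P @ Q" "length P = i"
  using assms by (metis append_take_drop_id length_take min.absorb2)

lemma level_split1:
  assumes "i < length L"
  obtains P s Q where "L = P @ s # Q" "length P = i"
  using assms id_take_nth_drop[of i L] by (metis length_take min.absorb2 less_imp_le)

lemma level_split2:
  assumes "Suc i < length L"
  obtains P s t Q where "L = P @ s # t # Q" "length P = i"
proof -
  obtain P s R where 1: "L = P @ s # R" "length P = i" using assms by (metis level_split1 Suc_lessD)
  then have "R \<noteq> []" using assms by auto
  with 1 that show ?thesis by (cases R) auto
qed

lemma level_split3:
  assumes "Suc (Suc i) < length L"
  obtains P r s t Q where "L = P @ r # s # t # Q" "length P = i"
proof -
  obtain P s t R where 1: "L = P @ s # t # R" "length P = i"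
    using assms by (metis level_split2 Suc_lessD)
  then have "R \<noteq> []" using assms by auto
  with 1 that show ?thesis by (cases R) auto
qed

lemmas pm_simps = tri_pm_cancel tri_pm_cancel[where p = "\<not> p" for p, simplified]
  cocycle_pm_cancel cocycle_pm_cancel[where p = "\<not> p" for p, simplified]

lemma signed_simps [simp]: "signed True a = a" "signed False a = - a"
  "signed (\<not> p) a = - signed p a" "signed p 0 = 0"
  "signed p (- a) = - signed p a" "signed p (a + b) = signed p a + signed p b"
  "signed p (a - b) = signed p a - signed p b"
  by (simp_all add: signed_def)

lemma transfer_R1_cup:
  assumes "valid L" "i \<le> length L"
  shows "transfer [Cup i b, Cross i k] L T m \<longleftrightarrow> transfer [Cup i (\<not> b)] L T m"
proof -
  obtain P Q where L: "L = P @ Q" "i = length P" using assms(2) by (auto elim: level_split)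
  show ?thesis by (cases k) (auto simp: L)
qed

text \<open>
  The maximum requires equal colors above the crossing. By idempotence this is the same as equal
  colors below it, and then the crossing has weight 0.
\<close>

lemma transfer_R1_cap:
  assumes "valid L" "Suc i < length L"
  shows "transfer [Cross i k, Cap i] L T m \<longleftrightarrow> transfer [Cap i] L T m"
proof -
  obtain P s t Q where L: "L = P @ s # t # Q" "i = length P"
    using assms(2) by (auto elim: level_split2)
  obtain p x q y where st: "s = (p, x)" "t = (q, y)" by (cases s; cases t)
  have xy: "x \<in> X" "y \<in> X" using assms(1) by (auto simp: L st)
  have "tri_pm r y x = x \<longleftrightarrow> x = y" "y = tri_pm r x y \<longleftrightarrow> x = y"
    "x = tri_pm r y x \<longleftrightarrow> x = y" "tri_pm r x y = y \<longleftrightarrow> x = y" for r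
    using xy by (metis tri_pm_cancel tri_pm_idem)+
  then show ?thesis using xy by (cases k) (auto simp: L st)
qed

lemma transfer_R2:
  assumes "valid L" "Suc i < length L"
  shows "transfer [Cross i k, Cross i (flip k)] L T m \<longleftrightarrow> transfer [] L T m"
proof -
  obtain P s t Q where L: "L = P @ s # t # Q" "i = length P"
    using assms(2) by (auto elim: level_split2)
  obtain p x q y where st: "s = (p, x)" "t = (q, y)" by (cases s; cases t)
  have "x \<in> X" "y \<in> X" using assms(1) by (auto simp: L st)
  then show ?thesis by (cases k) (auto simp: L st pm_simps)
qed

text \<open>
  The laws for a bottom, a middle and a top strand of colors x, y, z, oriented so that rewriting moves
  the passages below z inwards. The second and the fourth version cover a middle strand that has
  already passed below z.
\<close>

lemma pass_two:
  assumes "x \<in> X" "y \<in> X" "z \<in> X"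
  shows "tri_pm q (tri_pm p x y) z = tri_pm p (tri_pm q x z) (tri_pm q y z)"
    "tri_pm q (tri_pm p x (tri_pm r y z)) z =
       tri_pm p (tri_pm q x z) (tri_pm q (tri_pm r y z) z)"
    "cocycle_pm q (tri_pm p x y) z =
       cocycle_pm q x z + cocycle_pm p (tri_pm q x z) (tri_pm q y z) - cocycle_pm p x y"
    "cocycle_pm q (tri_pm p x (tri_pm r y z)) z =
       cocycle_pm q x z + cocycle_pm p (tri_pm q x z) (tri_pm q (tri_pm r y z) z)
       - cocycle_pm p x (tri_pm r y z)"
  using assms tri_pm_distrib[of x y z] tri_pm_distrib[of x "tri_pm r y z" z]
    cocycle_pm_distrib[of x y z p q] cocycle_pm_distrib[of x "tri_pm r y z" z p q]
  by (simp_all add: algebra_simps)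

definition admissible :: "crossing \<Rightarrow> crossing \<Rightarrow> crossing \<Rightarrow> bool" where
  "admissible c1 c2 c3 \<longleftrightarrow>
     Virtual \<notin> {c1, c2, c3} \<and> (c1, c2, c3) \<notin> {(Rising_Over, Falling_Over, Rising_Over),
                     (Falling_Over, Rising_Over, Falling_Over)}
   \<or> (c1 = Virtual \<and> c2 = Virtual) \<or> (c1 = Virtual \<and> c3 = Virtual) \<or>
        (c2 = Virtual \<and> c3 = Virtual)"

lemma admissible_intros:
  "Virtual \<notin> {c1, c2, c3} \<Longrightarrow> (c1, c2, c3) \<notin> {(Rising_Over, Falling_Over, Rising_Over),
     (Falling_Over, Rising_Over, Falling_Over)} \<Longrightarrow> admissible c1 c2 c3"
  "c1 = Virtual \<and> c2 = Virtual \<or> c1 = Virtual \<and> c3 = Virtual \<or>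
     c2 = Virtual \<and> c3 = Virtual \<Longrightarrow> admissible c1 c2 c3"
  by (simp_all add: admissible_def)

text \<open>
  The six admissible classical choices are the six orders of the three strands by height. In each of
  them the crossing of the middle and the top strand contributes the same to both sides, and the
  bottom strand passes below the other two in both orders. With two virtual crossings only one pair of
  strands interacts.
\<close>

lemma transfer_R3:
  assumes "valid L" "Suc (Suc i) < length L" "admissible c1 c2 c3"
  shows "transfer [Cross i c1, Cross (Suc i) c2, Cross i c3] L T m \<longleftrightarrow>
         transfer [Cross (Suc i) c3, Cross i c2, Cross (Suc i) c1] L T m"
proof -
  obtain P r s t Q where L: "L = P @ r # s # t # Q" "i = length P"
    using assms(2) by (auto elim: level_split3)
  obtain n x p y q z where st: "r = (n, x)" "s = (p, y)" "t = (q, z)"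
    by (cases r; cases s; cases t)
  have X: "x \<in> X" "y \<in> X" "z \<in> X" using assms(1) by (auto simp: L st)
  note simps = L st X pm_simps algebra_simps
  consider "c1 = Virtual \<and> c2 = Virtual \<or> c1 = Virtual \<and> c3 = Virtual \<or> c2 = Virtual \<and> c3 = Virtual"
    | "c1 = Rising_Over" "c2 = Rising_Over" "c3 = Rising_Over"
    | "c1 = Rising_Over" "c2 = Rising_Over" "c3 = Falling_Over"
    | "c1 = Rising_Over" "c2 = Falling_Over" "c3 = Falling_Over"
    | "c1 = Falling_Over" "c2 = Rising_Over" "c3 = Rising_Over"
    | "c1 = Falling_Over" "c2 = Falling_Over" "c3 = Rising_Over"
    | "c1 = Falling_Over" "c2 = Falling_Over" "c3 = Falling_Over"
    using assms(3) by (cases c1; cases c2; cases c3) (auto simp: admissible_def)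
  then show ?thesis
  proof cases
    case 1
    then show ?thesis by (cases c1; cases c2; cases c3) (auto simp: simps)
  next
    \<comment> \<open>The instances name the colors of the bottom, middle and top strand, in this order.\<close>
    case 2 then show ?thesis by (simp add: simps pass_two[of z y x])
  next
    case 3 then show ?thesis by (simp add: simps pass_two[of y z x])
  next
    case 4 then show ?thesis by (simp add: simps pass_two[of y x z])
  next
    case 5 then show ?thesis by (simp add: simps pass_two[of z x y])
  next
    case 6 then show ?thesis by (simp add: simps pass_two[of x z y])
  next
    case 7 then show ?thesis by (simp add: simps pass_two[of x y z])
  qed
qed

text \<open>
  If the minimum is under the strand, it is created on the other side of that strand, and the two
  sides of the move name its color on different sides. The names correspond by acting with the color
  of the strand.
\<close>

lemma transfer_slide_cup:
  assumes "valid L" "i < length L"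
  shows "transfer [Cup i b, Cross (Suc i) k] L T m \<longleftrightarrow>
         transfer [Cup (Suc i) b, Cross i (flip k)] L T m"
proof -
  obtain P s Q where L: "L = P @ s # Q" "i = length P"
    using assms(2) by (auto elim: level_split1)
  obtain p x where s: "s = (p, x)" by (cases s)
  have x: "x \<in> X" using assms(1) by (auto simp: L s)
  show ?thesis
  proof (cases k)
    case Falling_Over
    have "(\<exists>a\<in>X. R a) \<longleftrightarrow> (\<exists>a\<in>X. R (tri_pm p a x))" for R
      using x tri_pm_cancel[of _ x "\<not> p"] by (metis tri_pm_closed)
    from this[of "\<lambda>a. T = P @ (b, a) # (p, x) # (\<not> b, tri_pm (\<not> p) a x) # Q \<and>
        m + signed b (cocycle_pm (\<not> p) a x) = 0"]
    show ?thesis using x by (simp add: L s Falling_Over pm_simps cong: bex_cong)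
  qed (use x in \<open>auto simp: L s\<close>)
qed

lemma transfer_slide_cap:
  assumes "valid L" "Suc (Suc i) < length L"
  shows "transfer [Cross i k, Cap (Suc i)] L T m \<longleftrightarrow>
         transfer [Cross (Suc i) (flip k), Cap i] L T m"
proof -
  obtain P r s t Q where L: "L = P @ r # s # t # Q" "i = length P"
    using assms(2) by (auto elim: level_split3)
  obtain n x p y q z where st: "r = (n, x)" "s = (p, y)" "t = (q, z)"
    by (cases r; cases s; cases t)
  have X: "x \<in> X" "y \<in> X" "z \<in> X" using assms(1) by (auto simp: L st)
  show ?thesis
  proof (cases k)
    case Falling_Over
    then show ?thesis
      using X tri_pm_eq_iff[of x y z "\<not> p"] cocycle_pm_cancel[of x y "\<not> p"]
      by (auto simp: L st pm_simps)
  qed (use X in \<open>auto simp: L st\<close>)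
qed

lemma transfer_zigzag_left:
  assumes "valid L" "i < length L" "fst (L ! i) \<noteq> b"
  shows "transfer [Cup (Suc i) b, Cap i] L T m \<longleftrightarrow> transfer [] L T m"
proof -
  obtain P s Q where L: "L = P @ s # Q" "i = length P"
    using assms(2) by (auto elim: level_split1)
  obtain p x where s: "s = (p, x)" by (cases s)
  show ?thesis using assms by (auto simp: L s)
qed

lemma transfer_zigzag_right:
  assumes "valid L" "i < length L" "fst (L ! i) = b"
  shows "transfer [Cup i b, Cap (Suc i)] L T m \<longleftrightarrow> transfer [] L T m"
proof -
  obtain P s Q where L: "L = P @ s # Q" "i = length P"
    using assms(2) by (auto elim: level_split1)
  obtain p x where s: "s = (p, x)" by (cases s)
  show ?thesis using assms by (auto simp: L s)
qed

text \<open>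
  The weight of an event does not depend on the strands it leaves untouched.
\<close>

lemma step_weight_append:
  "length P = pos e \<Longrightarrow> length c = ins e \<Longrightarrow>
     step_weight e (P @ c @ Q) = step_weight (at_pos 0 e) c"
  by (cases e; cases c; cases "tl c") (auto simp: nth_append)

text \<open>
  Both orders of the two events are described by the same data \<open>far_apart\<close>.
\<close>

lemma transfer_exchange:
  assumes "pos e + outs e \<le> pos f"
  shows "transfer [e, f] L T m \<longleftrightarrow> transfer [at_pos (pos f - outs e + ins e) f, e] L T m"
    (is "_ \<longleftrightarrow> transfer [?f, e] L T m")
proof -
  have f0: "at_pos 0 (at_pos j f) = at_pos 0 f" for j by (cases f) auto
  have w: "step_weight e L = step_weight e M' \<and> step_weight f M = step_weight ?f L"
    if "far_apart e f L M M' T" for M M'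
    using that
  proof (rule far_apartE)
    fix P c c' Q d d' R
    assume "piece e c c'" "piece f d d'" "length P = pos e" "length P + outs e + length Q = pos f"
      "L = P @ c @ Q @ d @ R" "M = P @ c' @ Q @ d @ R" "M' = P @ c @ Q @ d' @ R"
    then show ?thesis
      using step_weight_append[of P e c] step_weight_append[of "P @ c' @ Q" f d R]
        step_weight_append[of "P @ c @ Q" ?f d R] piece_length[of e c c'] piece_length[of f d d']
      by (simp add: f0)
  qed
  have "transfer [e, f] L T m \<longleftrightarrow>
      (\<exists>M. step e L M \<and> step f M T \<and> m = step_weight e L + step_weight f M)"
    by (auto simp: transfer_Cons algebra_simps)
  also have "\<dots> \<longleftrightarrow> (\<exists>M M'. far_apart e f L M M' T \<and> m = step_weight e L + step_weight f M)"
    using far_apart_forward[OF assms] far_apart_steps by blast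
  also have "\<dots> \<longleftrightarrow> (\<exists>M M'. far_apart e f L M M' T \<and> m = step_weight ?f L + step_weight e M')"
    using w by (metis add.commute)
  also have "\<dots> \<longleftrightarrow>
      (\<exists>M. step ?f L M \<and> step e M T \<and> m = step_weight ?f L + step_weight e M)"
    using far_apart_backward[OF assms] far_apart_steps by blast
  also have "\<dots> \<longleftrightarrow> transfer [?f, e] L T m"
    by (auto simp: transfer_Cons algebra_simps)
  finally show ?thesis .
qed

lemma transfer_planar_isotopy:
  assumes "planar_isotopy w w'" "valid L"
    and "run (map fst L) w = Some s" "run (map fst L) w' = Some s'"
  shows "transfer w L T m \<longleftrightarrow> transfer w' L T m"
  using assms(1)
proof cases
  case (exchange e f)
  then show ?thesis using transfer_exchange by simp
next
  case (zigzag_left i b)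
  then show ?thesis using assms(2-)
    by (auto simp: transfer_zigzag_left nth_append split: if_splits)
next
  case (zigzag_right i b)
  then show ?thesis using assms(2-)
    by (auto simp: transfer_zigzag_right nth_append split: if_splits)
next
  case (slide_cup i b c)
  then show ?thesis using assms(2-)
    by (auto simp: transfer_slide_cup Option.bind_eq_Some_conv simp del: run.simps(1) split: if_splits)
next
  case (slide_cap i c)
  then show ?thesis using assms(2-)
    by (auto simp: transfer_slide_cap Option.bind_eq_Some_conv split: if_splits)
qed

lemma transfer_reidemeister:
  assumes "classical_reidemeister w w' \<or> virtual_reidemeister w w'" "valid L"
    and "run (map fst L) w = Some s" "run (map fst L) w' = Some s'"
  shows "transfer w L T m \<longleftrightarrow> transfer w' L T m"
proof -
  consider i b k where "w = [Cup i b, Cross i k]" "w' = [Cup i (\<not> b)]"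
    | i k where "w = [Cross i k, Cap i]" "w' = [Cap i]"
    | i k where "w = [Cross i k, Cross i (flip k)]" "w' = []"
    | i c1 c2 c3 where "w = [Cross i c1, Cross (Suc i) c2, Cross i c3]"
      "w' = [Cross (Suc i) c3, Cross i c2, Cross (Suc i) c1]" "admissible c1 c2 c3"
    using assms(1)
    by (elim disjE classical_reidemeister.cases virtual_reidemeister.cases)
      (blast intro: admissible_intros | metis flip.simps(3))+
  then show ?thesis
  proof cases
    case 1
    then show ?thesis using assms(2-) by (auto simp: transfer_R1_cup split: if_splits)
  next
    case 2
    then show ?thesis using assms(2-) by (auto simp: transfer_R1_cap split: if_splits)
  next
    case 3
    then show ?thesis using assms(2-) by (auto simp: transfer_R2 split: if_splits)
  next
    case 4
    have "Suc (Suc i) < length L" using assms(3) 4 by (auto split: if_splits)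
    then show ?thesis using transfer_R3 4 assms(2) by blast
  qed
qed

end

section \<open>Isomorphisms of weighted sets with endomorphisms\<close>

text \<open>
  An isomorphism between two sets on which the labels in S act by f and f', and on whose elements the
  labels in C take values by ev and ev'. Colorings and histories are both such sets, for endomorphisms
  and cocycles.
\<close>

definition weighted_iso ::
  "'s set \<Rightarrow> 'c set \<Rightarrow> 'v set \<Rightarrow> ('s \<Rightarrow> 'v \<Rightarrow> 'v) \<Rightarrow> ('c \<Rightarrow> 'v \<Rightarrow> 'a) \<Rightarrow>
     'w set \<Rightarrow> ('s \<Rightarrow> 'w \<Rightarrow> 'w) \<Rightarrow> ('c \<Rightarrow> 'w \<Rightarrow> 'a) \<Rightarrow> ('v \<Rightarrow> 'w) \<Rightarrow> bool" where
  "weighted_iso S C V f ev W f' ev' \<beta> \<longleftrightarrow>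
     bij_betw \<beta> V W \<and>
     (\<forall>\<sigma>\<in>S. \<forall>v\<in>V. f \<sigma> v \<in> V \<and> \<beta> (f \<sigma> v) = f' \<sigma> (\<beta> v)) \<and>
     (\<forall>\<phi>\<in>C. \<forall>v\<in>V. ev' \<phi> (\<beta> v) = ev \<phi> v)"

lemma weighted_iso_sym:
  assumes "weighted_iso S C V f ev W f' ev' \<beta>"
  shows "weighted_iso S C W f' ev' V f ev (inv_into V \<beta>)"
proof -
  have bij: "bij_betw \<beta> V W"
    and eqv: "\<And>\<sigma> v. \<sigma> \<in> S \<Longrightarrow> v \<in> V \<Longrightarrow> f \<sigma> v \<in> V \<and> \<beta> (f \<sigma> v) = f' \<sigma> (\<beta> v)"
    and ev: "\<And>\<phi> v. \<phi> \<in> C \<Longrightarrow> v \<in> V \<Longrightarrow> ev' \<phi> (\<beta> v) = ev \<phi> v"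
    using assms by (auto simp: weighted_iso_def)
  have inv: "inv_into V \<beta> (\<beta> v) = v" if "v \<in> V" for v
    using bij_betw_inv_into_left[OF bij that] .
  have "\<beta> ` V = W" using bij by (simp add: bij_betw_def)
  then have W: "\<exists>v\<in>V. w = \<beta> v" if "w \<in> W" for w using that by blast
  have "f' \<sigma> w \<in> W \<and> inv_into V \<beta> (f' \<sigma> w) = f \<sigma> (inv_into V \<beta> w)" if \<sigma>: "\<sigma> \<in> S" and w: "w \<in> W" for \<sigma> w
  proof -
    obtain v where v: "v \<in> V" "w = \<beta> v" using W[OF w] by blast
    have *: "f \<sigma> v \<in> V" "f' \<sigma> w = \<beta> (f \<sigma> v)" using eqv \<sigma> v by auto
    then show ?thesis using bij_betwE[OF bij] inv v by metis
  qed
  moreover have "ev \<phi> (inv_into V \<beta> w) = ev' \<phi> w" if "\<phi> \<in> C" "w \<in> W" for \<phi> w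
    using W[OF that(2)] inv ev[OF that(1)] by metis
  ultimately show ?thesis
    using bij_betw_inv_into[OF bij] by (simp add: weighted_iso_def)
qed

lemma weighted_iso_trans:
  assumes "weighted_iso S C U f ev V f' ev' \<beta>" "weighted_iso S C V f' ev' W f'' ev'' \<gamma>"
  shows "weighted_iso S C U f ev W f'' ev'' (\<gamma> \<circ> \<beta>)"
proof -
  have "\<beta> u \<in> V" if "u \<in> U" for u
    using assms(1) that by (auto simp: weighted_iso_def bij_betw_def)
  then show ?thesis
    using assms bij_betw_trans[of \<beta> U V \<gamma> W] by (simp add: weighted_iso_def)
qed

text \<open>
  A relation that is total and unique in both directions and compatible with actions and values is the
  graph of an isomorphism; compatibility with the actions makes the bijection equivariant by
  uniqueness.
\<close>

lemma weighted_iso_of_relation: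
  assumes left: "\<And>v. v \<in> V \<Longrightarrow> \<exists>w. R v w" and right: "\<And>w. w \<in> W \<Longrightarrow> \<exists>v. R v w"
    and dom: "\<And>v w. R v w \<Longrightarrow> v \<in> V \<and> w \<in> W"
    and right_unique: "\<And>v w w'. R v w \<Longrightarrow> R v w' \<Longrightarrow> w = w'"
    and left_unique: "\<And>v v' w. R v w \<Longrightarrow> R v' w \<Longrightarrow> v = v'"
    and eqv: "\<And>\<sigma> v w. \<sigma> \<in> S \<Longrightarrow> R v w \<Longrightarrow> R (f \<sigma> v) (f' \<sigma> w)"
    and ev: "\<And>\<phi> v w. \<phi> \<in> C \<Longrightarrow> R v w \<Longrightarrow> ev \<phi> v = ev' \<phi> w"
  shows "\<exists>\<beta>. weighted_iso S C V f ev W f' ev' \<beta>"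
proof -
  obtain \<beta> where \<beta>: "\<And>v. v \<in> V \<Longrightarrow> R v (\<beta> v)" using left by metis
  have "bij_betw \<beta> V W"
    unfolding bij_betw_def
  proof
    show "inj_on \<beta> V" using \<beta> left_unique by (metis inj_onI)
    show "\<beta> ` V = W" using \<beta> dom right right_unique by (blast intro: set_eqI)
  qed
  moreover have "f \<sigma> v \<in> V \<and> \<beta> (f \<sigma> v) = f' \<sigma> (\<beta> v)" if "\<sigma> \<in> S" "v \<in> V" for \<sigma> v
    using \<beta> eqv[OF that(1) \<beta>[OF that(2)]] dom right_unique by blast
  moreover have "ev' \<phi> (\<beta> v) = ev \<phi> v" if "\<phi> \<in> C" "v \<in> V" for \<phi> v
    using ev \<beta> that by metis
  ultimately show ?thesis unfolding weighted_iso_def by blast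
qed

section \<open>Replacing a part of a diagram\<close>

lemma run_append: "run s (u @ w) = Option.bind (run s u) (\<lambda>s'. run s' w)"
proof (induction u arbitrary: s)
  case (Cons e u)
  then show ?case by (cases "act s e") auto
qed simp

context quandle
begin

definition map_level :: "('x \<Rightarrow> 'x) \<Rightarrow> 'x strand list \<Rightarrow> 'x strand list" where
  "map_level \<sigma> = map (map_prod id \<sigma>)"

definition histories :: "event list \<Rightarrow> 'x strand list list set" where
  "histories D = {H. hist [] D H}"

lemma map_level_cross:
  assumes "\<sigma> \<in> quandle_End X tri" "snd s \<in> X" "snd t \<in> X"
  shows "map_level \<sigma> (cross k s t) = cross k (map_prod id \<sigma> s) (map_prod id \<sigma> t)"
proof -
  have "\<sigma> (tri_pm p x y) = tri_pm p (\<sigma> x) (\<sigma> y)" if "x \<in> X" "y \<in> X" for p x y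
    by (rule tri_hom_tri_pm) (use assms(1) that in \<open>auto simp: quandle_End_def\<close>)
  then show ?thesis
    using assms(2,3) by (cases "(k, s, t)" rule: cross.cases) (auto simp: map_level_def)
qed

text \<open>
  The rules for events are equations in the signed operation, so endomorphisms preserve them.
\<close>

lemma step_map_level:
  assumes "\<sigma> \<in> quandle_End X tri" "step e L L'" "valid L"
  shows "step e (map_level \<sigma> L) (map_level \<sigma> L')"
  using assms(2)
proof (rule step_decomp)
  fix P c c' Q
  assume *: "L = P @ c @ Q" "L' = P @ c' @ Q" "piece e c c'" "length P = pos e" "length c = ins e"
  have \<sigma>: "\<sigma> x \<in> X" if "x \<in> X" for x using assms(1) that by (auto simp: quandle_End_def)
  have "piece e (map_level \<sigma> c) (map_level \<sigma> c')"
    using *(1,3) assms(1,3) \<sigma> by (cases e) (auto simp: map_level_def map_level_cross[unfolded map_level_def])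
  then show ?thesis
    using * step_append[of "map_level \<sigma> P" e "map_level \<sigma> c" "map_level \<sigma> Q"]
    by (auto simp: map_level_def)
qed

lemma final_map: "final (map_level \<sigma> L) (map (map_level \<sigma>) H) = map_level \<sigma> (final L H)"
  by (induction H arbitrary: L) auto

lemma hist_map_level:
  assumes "\<sigma> \<in> quandle_End X tri"
  shows "hist L w H \<Longrightarrow> valid L \<Longrightarrow> hist (map_level \<sigma> L) w (map (map_level \<sigma>) H)"
  by (induction L w H rule: hist.induct) (auto intro: step_map_level[OF assms] dest: step_valid)

text \<open>
  The histories H and H' of u w v and u w' v agree outside w and w'.
\<close>

definition exchanged where
  "exchanged u w w' v H H' \<longleftrightarrow> (\<exists>A B B' G. H = A @ B @ G \<and> H' = A @ B' @ G \<and>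
     hist [] u A \<and> hist (final [] A) w B \<and> hist (final [] A) w' B' \<and>
     final (final [] A) B' = final (final [] A) B \<and> hist (final (final [] A) B) v G)"

lemma exchanged_sym: "exchanged u w w' v H H' \<Longrightarrow> exchanged u w' w v H' H"
  unfolding exchanged_def by metis

lemma exchanged_histories:
  assumes "exchanged u w w' v H H'"
  shows "H \<in> histories (u @ w @ v)"
  using assms hist_length by (auto simp: exchanged_def histories_def hist_append)

lemma exchanged_unique:
  assumes "exchanged u w w' v H H1" "exchanged u w w' v H H2" "rigid w'"
  shows "H1 = H2"
proof -
  obtain A B B1 G where 1: "H = A @ B @ G" "H1 = A @ B1 @ G" "hist [] u A"
    "hist (final [] A) w B" "hist (final [] A) w' B1"
    "final (final [] A) B1 = final (final [] A) B"
    using assms(1) unfolding exchanged_def by blast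
  obtain A' B' B2 G' where 2: "H = A' @ B' @ G'" "H2 = A' @ B2 @ G'" "hist [] u A'"
    "hist (final [] A') w B'" "hist (final [] A') w' B2"
    "final (final [] A') B2 = final (final [] A') B'"
    using assms(2) unfolding exchanged_def by blast
  have "A = A'" "B = B'" "G = G'"
    using 1(1,3,4) 2(1,3,4) hist_length by (metis append_eq_append_conv)+
  moreover have "valid (final [] A)" using hist_valid[OF 1(3)] by simp
  ultimately have "B1 = B2" using assms(3) 1 2 unfolding rigid_def by metis
  then show ?thesis using 1 2 \<open>A = A'\<close> \<open>G = G'\<close> by simp
qed

lemma exchanged_map:
  assumes "exchanged u w w' v H H'" "\<sigma> \<in> quandle_End X tri"
  shows "exchanged u w w' v (map (map_level \<sigma>) H) (map (map_level \<sigma>) H')"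
proof -
  obtain A B B' G where *: "H = A @ B @ G" "H' = A @ B' @ G" "hist [] u A"
    "hist (final [] A) w B" "hist (final [] A) w' B'"
    "final (final [] A) B' = final (final [] A) B" "hist (final (final [] A) B) v G"
    using assms(1) unfolding exchanged_def by blast
  have valid: "valid (final [] A)" "valid (final (final [] A) B)"
    using hist_valid *(3,4) by auto
  have nil: "map_level \<sigma> [] = []" by (simp add: map_level_def)
  let ?m = "map (map_level \<sigma>)"
  have f: "final [] (?m A) = map_level \<sigma> (final [] A)" using final_map[of \<sigma> "[]" A] nil by simp
  have "hist [] u (?m A)" using hist_map_level[OF assms(2) *(3)] nil by simp
  moreover have "hist (final [] (?m A)) w (?m B)" "hist (final [] (?m A)) w' (?m B')"
    unfolding f using hist_map_level[OF assms(2)] *(4,5) valid by auto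
  moreover have "final (final [] (?m A)) (?m B') = final (final [] (?m A)) (?m B)"
    "hist (final (final [] (?m A)) (?m B)) v (?m G)"
    unfolding f final_map using hist_map_level[OF assms(2)] *(6,7) valid by auto
  moreover have "?m H = ?m A @ ?m B @ ?m G" "?m H' = ?m A @ ?m B' @ ?m G" using *(1,2) by simp_all
  ultimately show ?thesis unfolding exchanged_def by blast
qed

end

context quandle_cocycle
begin

lemma weight_append:
  "length H1 = length u \<Longrightarrow>
     weight L (u @ w) (H1 @ H2) = weight L u H1 + weight (final L H1) w H2"
  by (induction H1 u arbitrary: L rule: list_induct2) (auto simp: add.assoc)

text \<open>
  If w' can reach every top level that w can reach, with the same weight, then the part of a history
  belonging to w can be replaced.
\<close>

lemma exchange_transfer:
  assumes "H \<in> histories (u @ w @ v)" and s: "run [] (u @ w' @ v) = Some s"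
    and transfer: "\<And>L T m s s'. valid L \<Longrightarrow> run (map fst L) w = Some s \<Longrightarrow>
      run (map fst L) w' = Some s' \<Longrightarrow> transfer w L T m \<Longrightarrow> transfer w' L T m"
  shows "\<exists>H'. exchanged u w w' v H H' \<and> weight [] (u @ w' @ v) H' = weight [] (u @ w @ v) H"
proof -
  obtain A B G where H: "H = A @ B @ G" "hist [] u A" "hist (final [] A) w B"
    "hist (final (final [] A) B) v G"
    using assms(1) unfolding histories_def by (auto elim!: hist_appendE)
  have "run [] u = Some (map fst (final [] A))" using hist_run[OF H(2)] by simp
  with s obtain s' where s': "run (map fst (final [] A)) w' = Some s'"
    by (auto simp: run_append Option.bind_eq_Some_conv)
  have "transfer w' (final [] A) (final (final [] A) B) (weight (final [] A) w B)"
  proof (rule transfer[OF _ _ s'])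
    show "valid (final [] A)" using hist_valid[OF H(2)] by simp
    show "run (map fst (final [] A)) w = Some (map fst (final (final [] A) B))"
      using hist_run[OF H(3)] .
    show "transfer w (final [] A) (final (final [] A) B) (weight (final [] A) w B)"
      using H(3) by (auto simp: transfer_def)
  qed
  then obtain B' where B': "hist (final [] A) w' B'"
    "final (final [] A) B' = final (final [] A) B" "weight (final [] A) w' B' = weight (final [] A) w B"
    by (auto simp: transfer_def)
  have "exchanged u w w' v H (A @ B' @ G)" unfolding exchanged_def using H B' by blast
  moreover have "weight [] (u @ w' @ v) (A @ B' @ G) = weight [] (u @ w @ v) H"
    using H B' hist_length by (simp add: weight_append final_append)
  ultimately show ?thesis by blast
qed

end

context quandle
begin

definition move :: "event list \<Rightarrow> event list \<Rightarrow> bool" where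
  "move w w' \<longleftrightarrow>
     planar_isotopy w w' \<or> classical_reidemeister w w' \<or> virtual_reidemeister w w'"

abbreviation history_weight where
  "history_weight D \<phi> H \<equiv> quandle_cocycle.weight X tri \<phi> [] D H"

text \<open>
  It serves to transfer the bare existence of histories, for which no cocycle is given.
\<close>

lemma zero_cocycle: "(\<lambda>p\<in>X \<times> X. 0) \<in> quandle_cocycles X tri"
  by (auto simp: quandle_cocycles_def closed)

text \<open>
  Transfer gives existence of the replacement in both directions and the equality of weights, and
  rigidity gives its uniqueness.
\<close>

lemma histories_move:
  assumes "virtual_diagram (u @ w @ v)" "virtual_diagram (u @ w' @ v)" "move w w'"
    and "S \<subseteq> quandle_End X tri" and "C \<subseteq> quandle_cocycles X tri"
  shows "\<exists>\<beta>. weighted_iso S C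
    (histories (u @ w @ v)) (\<lambda>\<sigma>. map (map_level \<sigma>)) (history_weight (u @ w @ v))
    (histories (u @ w' @ v)) (\<lambda>\<sigma>. map (map_level \<sigma>)) (history_weight (u @ w' @ v)) \<beta>"
proof -
  have rigid: "rigid w" "rigid w'"
    using assms(3) rigid_planar_isotopy rigid_reidemeister unfolding move_def by blast+
  have forward: "\<exists>H'. exchanged u w w' v H H' \<and>
      history_weight (u @ w' @ v) \<phi> H' = history_weight (u @ w @ v) \<phi> H"
    if "H \<in> histories (u @ w @ v)" "\<phi> \<in> quandle_cocycles X tri" for H \<phi>
  proof -
    interpret quandle_cocycle X tri \<phi> by unfold_locales fact
    show ?thesis
    proof (rule exchange_transfer[OF that(1)])
      show "run [] (u @ w' @ v) = Some []" using assms(2) by (simp add: virtual_diagram_def)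
    qed (use assms(3) transfer_planar_isotopy transfer_reidemeister in \<open>unfold move_def, blast\<close>)
  qed
  have backward: "\<exists>H. exchanged u w' w v H' H"
    if "H' \<in> histories (u @ w' @ v)" for H'
  proof -
    let ?\<phi> = "\<lambda>p\<in>X \<times> X. 0 :: int"
    interpret quandle_cocycle X tri ?\<phi> by unfold_locales (rule zero_cocycle)
    have "run [] (u @ w @ v) = Some []" using assms(1) by (simp add: virtual_diagram_def)
    then show ?thesis
      using exchange_transfer[OF that, of w "[]"] assms(3)
        transfer_planar_isotopy[of w w'] transfer_reidemeister[of w w']
      unfolding move_def by blast
  qed
  show ?thesis
  proof (rule weighted_iso_of_relation[where R = "exchanged u w w' v"])
    show "\<exists>H'. exchanged u w w' v H H'" if "H \<in> histories (u @ w @ v)" for H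
      using forward[OF that zero_cocycle] by blast
    show "\<exists>H. exchanged u w w' v H H'" if "H' \<in> histories (u @ w' @ v)" for H'
      using backward[OF that] exchanged_sym by blast
    show "H \<in> histories (u @ w @ v) \<and> H' \<in> histories (u @ w' @ v)" if "exchanged u w w' v H H'" for H H'
      using that exchanged_histories exchanged_sym by blast
    show "H1 = H2" if "exchanged u w w' v H H1" "exchanged u w w' v H H2" for H H1 H2
      using exchanged_unique that rigid by blast
    show "H1 = H2" if "exchanged u w w' v H1 H" "exchanged u w w' v H2 H" for H H1 H2
      using exchanged_unique[of u w' w] that exchanged_sym rigid by blast
    show "history_weight (u @ w @ v) \<phi> H = history_weight (u @ w' @ v) \<phi> H'"
      if "\<phi> \<in> C" "exchanged u w w' v H H'" for \<phi> H H'
      using forward[OF exchanged_histories[OF that(2)], of \<phi>] exchanged_unique that assms(5) rigid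
      by (metis subsetD)
  qed (use exchanged_map assms(4) in blast)
qed

end

section \<open>Colorings as histories\<close>

lemma act_pos:
  assumes "act s e = Some s'"
  shows "pos e + ins e \<le> length s" "length s' + ins e = length s + outs e"
    "pos e + outs e \<le> length s'"
    "take (pos e) s' = take (pos e) s" "drop (pos e + outs e) s' = drop (pos e + ins e) s"
  using assms by (cases e; auto split: if_splits)+

lemma level_0: "level D 0 = []"
  by (simp add: level_def)

lemma diagram_arcs_eq: "diagram_arcs D = arc_of D ` points D"
  by (auto simp: diagram_arcs_def arc_of_def quotient_def)

context
  fixes D :: "event list"
  assumes D: "virtual_diagram D"
begin

lemma run_take:
  assumes "n \<le> length D"
  shows "run [] (take n D) = Some (level D n)"
proof -
  have "run [] (take n D @ drop n D) = Some []" using D by (simp add: virtual_diagram_def)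
  then show ?thesis unfolding run_append level_def by (auto simp: Option.bind_eq_Some_conv)
qed

lemma act_level:
  assumes "n < length D"
  shows "act (level D n) (D ! n) = Some (level D (Suc n))"
proof -
  have "run [] (take n D @ [D ! n]) = Some (level D (Suc n))"
    using run_take[of "Suc n"] assms by (simp add: take_Suc_conv_app_nth)
  moreover have "run [] (take n D) = Some (level D n)" using run_take assms by simp
  ultimately show ?thesis unfolding run_append by (simp add: Option.bind_eq_Some_conv)
qed

lemmas event_level = act_pos[OF act_level]

text \<open>
  The relation \<open>joined\<close> is not restricted to points of the diagram, but it never leads
  out of them. Thus equivalent points are connected through points of the diagram.
\<close>

lemma joined_points:
  assumes "joined D a b"
  shows "a \<in> points D \<longleftrightarrow> b \<in> points D"
  using assms
proof cases
  case (left_of_event n p)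
  then show ?thesis using event_level(1,3)[of n] by (auto simp: points_def)
next
  case (right_of_event n q)
  then show ?thesis using event_level(1,2,3)[of n] by (auto simp: points_def)
next
  case (cup n i b)
  then show ?thesis using event_level(3)[of n] by (auto simp: points_def)
next
  case (cap n i)
  then show ?thesis using event_level(1)[of n] by (auto simp: points_def)
next
  case (rising n i c)
  then show ?thesis using event_level(1,3)[of n] by (auto simp: points_def)
next
  case (falling n i c)
  then show ?thesis using event_level(1,3)[of n] by (auto simp: points_def)
qed

lemma equivclp_joined_points:
  assumes "equivclp (joined D) a b"
  shows "a \<in> points D \<longleftrightarrow> b \<in> points D"
  using assms by (induction rule: equivclp_induct) (auto simp: joined_points)

lemma equiv_same_arc: "equiv (points D) (same_arc D)"
  unfolding same_arc_def
  by (rule equivI) (auto simp: refl_on_def sym_def trans_def intro: equivclp_sym equivclp_trans)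

lemma arc_of_in_arcs [simp]: "a \<in> points D \<Longrightarrow> arc_of D a \<in> diagram_arcs D"
  by (simp add: arc_of_def diagram_arcs_def quotientI)

lemma arc_of_joined:
  assumes "joined D a b" "a \<in> points D"
  shows "arc_of D a = arc_of D b"
  unfolding arc_of_def
  by (rule equiv_class_eq[OF equiv_same_arc])
    (use assms joined_points in \<open>auto simp: same_arc_def\<close>)

lemma crossing_points:
  assumes "n \<in> classical_crossings D"
  shows "left_point D n \<in> points D" "right_point D n \<in> points D" "over_point D n \<in> points D"
proof -
  obtain i c where "D ! n = Cross i c" "n < length D"
    using assms by (auto simp: classical_crossings_def)
  then show "left_point D n \<in> points D" "right_point D n \<in> points D" "over_point D n \<in> points D"
    using event_level(1,3)[of n]
    by (auto simp: left_point_def right_point_def over_point_def points_def)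
qed

end

context quandle
begin

definition colored_level :: "event list \<Rightarrow> (point \<Rightarrow> 'x) \<Rightarrow> nat \<Rightarrow> 'x strand list" where
  "colored_level D f n = map (\<lambda>p. (level D n ! p, f (n, p))) [0..<length (level D n)]"

text \<open>
  The conditions on a coloring of points that concern the slice of event n: constancy along the pieces
  without undercrossing, and the relation at a classical crossing.
\<close>

definition locally_colored :: "event list \<Rightarrow> (point \<Rightarrow> 'x) \<Rightarrow> nat \<Rightarrow> bool" where
  "locally_colored D f n \<longleftrightarrow>
     (\<forall>p<pos (D ! n). f (n, p) = f (Suc n, p)) \<and>
     (\<forall>q. pos (D ! n) + ins (D ! n) + q < length (level D n) \<longrightarrow>
        f (n, pos (D ! n) + ins (D ! n) + q) = f (Suc n, pos (D ! n) + outs (D ! n) + q)) \<and>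
     (case D ! n of
        Cup i b \<Rightarrow> f (Suc n, i) = f (Suc n, Suc i)
      | Cap i \<Rightarrow> f (n, i) = f (n, Suc i)
      | Cross i c \<Rightarrow>
          (c \<noteq> Falling_Over \<longrightarrow> f (n, i) = f (Suc n, Suc i)) \<and>
          (c \<noteq> Rising_Over \<longrightarrow> f (n, Suc i) = f (Suc n, i)) \<and>
          (c \<noteq> Virtual \<longrightarrow>
            f (left_point D n) = tri (f (right_point D n)) (f (over_point D n))))"

lemma colored_level_simps [simp]:
  "length (colored_level D f n) = length (level D n)"
  "p < length (level D n) \<Longrightarrow> colored_level D f n ! p = (level D n ! p, f (n, p))"
  "map fst (colored_level D f n) = level D n"
  by (auto simp: colored_level_def comp_def map_nth)

lemma take_drop_2: "Suc i < length L \<Longrightarrow> take 2 (drop i L) = [L ! i, L ! Suc i]"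
  by (auto simp: Cons_nth_drop_Suc[symmetric] numeral_2_eq_2)

lemma drop_eq_drop_iff:
  assumes "a \<le> length xs" "b \<le> length ys" "length xs + b = length ys + a"
  shows "drop a xs = drop b ys \<longleftrightarrow> (\<forall>q. b + q < length ys \<longrightarrow> xs ! (a + q) = ys ! (b + q))"
proof -
  have len: "length xs - a = length ys - b" using assms by linarith
  have "drop a xs = drop b ys \<longleftrightarrow> (\<forall>q<length ys - b. drop a xs ! q = drop b ys ! q)"
    unfolding list_eq_iff_nth_eq length_drop len by blast
  also have "\<dots> \<longleftrightarrow> (\<forall>q<length ys - b. xs ! (a + q) = ys ! (b + q))"
    using assms(1,2) by simp
  also have "\<dots> \<longleftrightarrow> (\<forall>q. b + q < length ys \<longrightarrow> xs ! (a + q) = ys ! (b + q))"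
    by (simp only: less_diff_conv add.commute[of _ b])
  finally show ?thesis .
qed

text \<open>
  At a crossing the relation between left and right color says that the upper under-strand is the
  signed operation applied to the lower one; whether it is the operation or its inverse depends on the
  direction of the over-strand, which decides if the right-hand side is below or above.
\<close>

lemma step_colored_level:
  assumes D: "virtual_diagram D" and n: "n < length D" and f: "\<And>a. a \<in> points D \<Longrightarrow> f a \<in> X"
  shows "step (D ! n) (colored_level D f n) (colored_level D f (Suc n)) \<longleftrightarrow> locally_colored D f n"
proof -
  let ?e = "D ! n" and ?L = "colored_level D f n" and ?L' = "colored_level D f (Suc n)"
  note act = act_level[OF D n]
  note ev = event_level[OF D n]
  have fX: "f (n, p) \<in> X" if "p < length (level D n)" for p
    using f that n by (simp add: points_def)
  have fX': "f (Suc n, p) \<in> X" if "p < length (level D (Suc n))" for p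
    using f that n by (simp add: points_def)
  have dir_left: "level D (Suc n) ! p = level D n ! p" if "p < pos ?e" for p
    using ev(4) that by (metis nth_take)
  have dir_right: "level D (Suc n) ! (pos ?e + outs ?e + q) = level D n ! (pos ?e + ins ?e + q)"
    if "pos ?e + ins ?e + q < length (level D n)" for q
  proof -
    have "drop (pos ?e + outs ?e) (level D (Suc n)) ! q = drop (pos ?e + ins ?e) (level D n) ! q"
      using ev(5) by simp
    then show ?thesis using ev(1,3) by simp
  qed
  have left: "take (pos ?e) ?L' = take (pos ?e) ?L \<longleftrightarrow> (\<forall>p<pos ?e. f (n, p) = f (Suc n, p))"
  proof -
    have len: "pos ?e < length (level D n) \<or> pos ?e = length (level D n)" "pos ?e \<le> length (level D n)"
      "pos ?e \<le> length (level D (Suc n))" using ev(1,3) by auto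
    have "?L' ! p = ?L ! p \<longleftrightarrow> f (n, p) = f (Suc n, p)" if "p < pos ?e" for p
      using that len dir_left[OF that] by auto
    then show ?thesis using len by (simp add: list_eq_iff_nth_eq)
  qed
  have "drop (pos ?e + outs ?e) ?L' = drop (pos ?e + ins ?e) ?L \<longleftrightarrow>
     (\<forall>q. pos ?e + ins ?e + q < length (level D n) \<longrightarrow>
        ?L' ! (pos ?e + outs ?e + q) = ?L ! (pos ?e + ins ?e + q))"
    using drop_eq_drop_iff[of "pos ?e + outs ?e" ?L' "pos ?e + ins ?e" ?L] ev(1,2,3) by simp
  also have "\<dots> \<longleftrightarrow> (\<forall>q. pos ?e + ins ?e + q < length (level D n) \<longrightarrow>
        f (n, pos ?e + ins ?e + q) = f (Suc n, pos ?e + outs ?e + q))"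
  proof (intro all_cong)
    fix q assume q: "pos ?e + ins ?e + q < length (level D n)"
    then have "pos ?e + outs ?e + q < length (level D (Suc n))" using ev(2) by simp
    with q dir_right[OF q] show "?L' ! (pos ?e + outs ?e + q) = ?L ! (pos ?e + ins ?e + q) \<longleftrightarrow>
        f (n, pos ?e + ins ?e + q) = f (Suc n, pos ?e + outs ?e + q)" by auto
  qed
  finally have right: "drop (pos ?e + outs ?e) ?L' = drop (pos ?e + ins ?e) ?L \<longleftrightarrow>
     (\<forall>q. pos ?e + ins ?e + q < length (level D n) \<longrightarrow>
        f (n, pos ?e + ins ?e + q) = f (Suc n, pos ?e + outs ?e + q))" .
  have piece: "piece ?e (take (ins ?e) (drop (pos ?e) ?L)) (take (outs ?e) (drop (pos ?e) ?L')) \<longleftrightarrow>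
     (case ?e of
        Cup i b \<Rightarrow> f (Suc n, i) = f (Suc n, Suc i)
      | Cap i \<Rightarrow> f (n, i) = f (n, Suc i)
      | Cross i c \<Rightarrow>
          (c \<noteq> Falling_Over \<longrightarrow> f (n, i) = f (Suc n, Suc i)) \<and>
          (c \<noteq> Rising_Over \<longrightarrow> f (n, Suc i) = f (Suc n, i)) \<and>
          (c \<noteq> Virtual \<longrightarrow>
            f (left_point D n) = tri (f (right_point D n)) (f (over_point D n))))"
  proof (cases ?e)
    case (Cup i b)
    have "level D (Suc n) = take i (level D n) @ [b, \<not> b] @ drop i (level D n)"
      "i \<le> length (level D n)"
      using act by (auto simp: Cup split: if_splits)
    then have "level D (Suc n) ! i = b" "level D (Suc n) ! Suc i = (\<not> b)"
      by (simp_all add: nth_append)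
    then show ?thesis using ev(3) fX' by (auto simp: Cup take_drop_2)
  next
    case (Cap i)
    have "level D n ! i \<noteq> level D n ! Suc i" using act by (auto simp: Cap split: if_splits)
    then show ?thesis using ev(1) by (auto simp: Cap take_drop_2)
  next
    case (Cross i c)
    have dir: "level D (Suc n) ! i = level D n ! Suc i" "level D (Suc n) ! Suc i = level D n ! i"
    proof -
      have "level D (Suc n) = (level D n)[i := level D n ! Suc i, Suc i := level D n ! i]"
        "Suc i < length (level D n)"
        using act by (auto simp: Cross split: if_splits)
      then show "level D (Suc n) ! i = level D n ! Suc i" "level D (Suc n) ! Suc i = level D n ! i"
        by (simp_all add: nth_list_update)
    qed
    have i: "Suc i < length (level D n)" "Suc i < length (level D (Suc n))"
      using ev(1,3) by (auto simp: Cross)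
    have X: "f (n, i) \<in> X" "f (n, Suc i) \<in> X" "f (Suc n, i) \<in> X" "f (Suc n, Suc i) \<in> X"
      using fX fX' i by auto
    have inv: "y = tri_pm False x z \<longleftrightarrow> x = tri y z" if "x \<in> X" "y \<in> X" "z \<in> X" for x y z
      using tri_pm_eq_iff[of x z y False] that by auto
    show ?thesis
      using i X by (cases c; cases "level D n ! i"; cases "level D n ! Suc i")
        (auto simp: Cross take_drop_2 dir left_point_def right_point_def over_point_def inv)
  qed
  show ?thesis
    unfolding step_def locally_colored_def left right piece using ev(1,3) by simp
qed

lemma locally_colored_iff:
  assumes D: "virtual_diagram D"
  shows "(\<forall>n<length D. locally_colored D f n) \<longleftrightarrow>
    (\<forall>a b. joined D a b \<longrightarrow> a \<in> points D \<longrightarrow> f a = f b) \<and>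
    (\<forall>n\<in>classical_crossings D.
       f (left_point D n) = tri (f (right_point D n)) (f (over_point D n)))"
    (is "?L \<longleftrightarrow> ?J \<and> ?C")
proof (intro iffI conjI)
  assume L: ?L
  show ?C using L by (fastforce simp: classical_crossings_def locally_colored_def)
  show ?J
  proof (intro allI impI)
    fix a b assume "joined D a b" "a \<in> points D"
    then show "f a = f b"
      by cases (use L in \<open>force simp: locally_colored_def points_def\<close>)+
  qed
next
  assume JC: "?J \<and> ?C"
  show ?L
  proof (intro allI impI)
    fix n assume n: "n < length D"
    note ev = event_level[OF D n]
    have J: "f a = f b" if "joined D a b" "a \<in> points D" for a b using JC that by blast
    have pt: "(n, p) \<in> points D" if "p < length (level D n)" for p
      using that n by (simp add: points_def)
    have pt': "(Suc n, p) \<in> points D" if "p < length (level D (Suc n))" for p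
      using that n by (simp add: points_def)
    show "locally_colored D f n"
      unfolding locally_colored_def
    proof (intro conjI allI impI)
      show "f (n, p) = f (Suc n, p)" if "p < pos (D ! n)" for p
        using J[OF joined.left_of_event[OF n that]] pt that ev(1) by simp
      show "f (n, pos (D ! n) + ins (D ! n) + q) = f (Suc n, pos (D ! n) + outs (D ! n) + q)"
        if "pos (D ! n) + ins (D ! n) + q < length (level D n)" for q
        using J[OF joined.right_of_event[OF n] pt[OF that]] .
      show "case D ! n of
        Cup i b \<Rightarrow> f (Suc n, i) = f (Suc n, Suc i)
      | Cap i \<Rightarrow> f (n, i) = f (n, Suc i)
      | Cross i c \<Rightarrow>
          (c \<noteq> Falling_Over \<longrightarrow> f (n, i) = f (Suc n, Suc i)) \<and>
          (c \<noteq> Rising_Over \<longrightarrow> f (n, Suc i) = f (Suc n, i)) \<and>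
          (c \<noteq> Virtual \<longrightarrow>
            f (left_point D n) = tri (f (right_point D n)) (f (over_point D n)))"
      proof (cases "D ! n")
        case (Cup i b)
        then show ?thesis using J[OF joined.cup[OF n Cup]] pt' ev(3) by simp
      next
        case (Cap i)
        then show ?thesis using J[OF joined.cap[OF n Cap]] pt ev(1) by simp
      next
        case (Cross i c)
        have "n \<in> classical_crossings D" if "c \<noteq> Virtual"
          using that n Cross by (simp add: classical_crossings_def)
        then show ?thesis
          using J[OF joined.rising[OF n Cross]] J[OF joined.falling[OF n Cross]] pt ev(1) JC Cross
          by simp
      qed
    qed
  qed
qed

lemma hist_nth:
  "hist L w H \<longleftrightarrow>
     length H = length w \<and> (\<forall>n<length w. step (w ! n) ((L # H) ! n) ((L # H) ! Suc n))"
proof (induction L w H rule: hist.induct)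
  case (3 L e es L' H)
  have "(\<forall>n<length (e # es). step ((e # es) ! n) ((L # L' # H) ! n) ((L # L' # H) ! Suc n)) \<longleftrightarrow>
    step e L L' \<and> (\<forall>n<length es. step (es ! n) ((L' # H) ! n) ((L' # H) ! Suc n))"
    by (auto simp: All_less_Suc2)
  then show ?case using 3 by (auto simp del: nth_Cons_Suc)
qed auto

lemma hist_level:
  "hist L w H \<Longrightarrow> n \<le> length w \<Longrightarrow> run (map fst L) (take n w) = Some (map fst ((L # H) ! n))"
proof (induction L w H arbitrary: n rule: hist.induct)
  case (3 L e es L' H)
  then show ?case by (cases n) (auto dest: step_act)
qed auto

lemma hist_nth_valid: "hist L w H \<Longrightarrow> valid L \<Longrightarrow> n \<le> length w \<Longrightarrow> valid ((L # H) ! n)"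
proof (induction L w H arbitrary: n rule: hist.induct)
  case (3 L e es L' H)
  then show ?case by (cases n) (auto dest: step_valid)
qed auto

definition history :: "event list \<Rightarrow> (diagram_arc \<Rightarrow> 'x) \<Rightarrow> 'x strand list list" where
  "history D v = map (colored_level D (v \<circ> arc_of D)) [1..<Suc (length D)]"

lemma history_nth:
  assumes "virtual_diagram D" "n \<le> length D"
  shows "([] # history D v) ! n = colored_level D (v \<circ> arc_of D) n"
proof (cases n)
  case 0
  then show ?thesis by (simp add: colored_level_def level_0)
next
  case (Suc m)
  then show ?thesis using assms(2) by (simp add: history_def del: upt_Suc)
qed

lemma coloring_closed:
  "v \<in> colorings X tri D \<Longrightarrow> a \<in> points D \<Longrightarrow> (v \<circ> arc_of D) a \<in> X"
  by (auto simp: colorings_def diagram_arcs_eq)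

lemma coloring_locally_colored:
  assumes "virtual_diagram D" "v \<in> colorings X tri D" "n < length D"
  shows "locally_colored D (v \<circ> arc_of D) n"
proof -
  have "\<forall>n<length D. locally_colored D (v \<circ> arc_of D) n"
    unfolding locally_colored_iff[OF assms(1)]
    using assms(2) arc_of_joined[OF assms(1)] by (auto simp: colorings_def)
  then show ?thesis using assms(3) by blast
qed

lemma history_in_histories:
  assumes "virtual_diagram D" "v \<in> colorings X tri D"
  shows "history D v \<in> histories D"
proof -
  have "step (D ! n) (([] # history D v) ! n) (([] # history D v) ! Suc n)" if "n < length D" for n
    using step_colored_level[OF assms(1) that, of "v \<circ> arc_of D"]
      coloring_locally_colored[OF assms that] coloring_closed[OF assms(2)] that
      history_nth[OF assms(1), of n v] history_nth[OF assms(1), of "Suc n" v] by simp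
  then show ?thesis by (simp add: histories_def hist_nth history_def del: upt_Suc)
qed

lemma history_inj:
  assumes "virtual_diagram D"
  shows "inj_on (history D) (colorings X tri D)"
proof (rule inj_onI)
  fix v v' assume v: "v \<in> colorings X tri D" "v' \<in> colorings X tri D" "history D v = history D v'"
  show "v = v'"
  proof (rule PiE_ext[of v "diagram_arcs D" "\<lambda>_. X" v'])
    fix A assume "A \<in> diagram_arcs D"
    then obtain n p where A: "A = arc_of D (n, p)" "(n, p) \<in> points D"
      by (auto simp: diagram_arcs_eq)
    then have np: "n \<le> length D" "p < length (level D n)" by (auto simp: points_def)
    have "colored_level D (v \<circ> arc_of D) n ! p = colored_level D (v' \<circ> arc_of D) n ! p"
      using history_nth[OF assms np(1)] v(3) by metis
    then show "v A = v' A" using A np by simp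
  qed (use v in \<open>auto simp: colorings_def\<close>)
qed

text \<open>
  A history colors the points. It is constant along arcs, since all steps are locally colored, so it
  induces a coloring of arcs by choosing a point on each of them.
\<close>

lemma history_surj:
  assumes D: "virtual_diagram D" and H: "H \<in> histories D"
  shows "\<exists>v\<in>colorings X tri D. history D v = H"
proof -
  define f where "f = (\<lambda>(n, p). snd (([] # H) ! n ! p))"
  have hist: "hist [] D H" using H by (simp add: histories_def)
  have fst: "map fst (([] # H) ! n) = level D n" if "n \<le> length D" for n
    using hist_level[OF hist that] run_take[OF D that] by simp
  have len: "length (([] # H) ! n) = length (level D n)" if "n \<le> length D" for n
    using fst[OF that] by (metis length_map)
  have level: "colored_level D g n = ([] # H) ! n"
    if n: "n \<le> length D" and g: "\<And>a. a \<in> points D \<Longrightarrow> g a = f a" for g n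
  proof (rule nth_equalityI)
    fix p assume "p < length (colored_level D g n)"
    then have p: "p < length (level D n)" by simp
    have "g (n, p) = snd (([] # H) ! n ! p)" using g[of "(n, p)"] p n by (simp add: f_def points_def)
    moreover have "level D n ! p = fst (([] # H) ! n ! p)"
      using fst[OF n] p len[OF n] by (metis nth_map)
    ultimately show "colored_level D g n ! p = ([] # H) ! n ! p" using p by simp
  qed (use len n in simp)
  have fX: "f a \<in> X" if "a \<in> points D" for a
  proof -
    obtain n p where a: "a = (n, p)" "n \<le> length D" "p < length (level D n)"
      using \<open>a \<in> points D\<close> by (auto simp: points_def)
    have "valid (([] # H) ! n)" using hist_nth_valid[OF hist _ a(2)] by simp
    moreover have "([] # H) ! n ! p \<in> set (([] # H) ! n)" using a len by simp
    ultimately show ?thesis unfolding f_def a valid_def by force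
  qed
  have "locally_colored D f n" if "n < length D" for n
    using hist that level[of n f] level[of "Suc n" f] step_colored_level[OF D that, of f, OF fX]
    by (simp add: hist_nth del: nth_Cons_Suc)
  then have f: "\<And>a b. joined D a b \<Longrightarrow> a \<in> points D \<Longrightarrow> f a = f b"
      "\<And>n. n \<in> classical_crossings D \<Longrightarrow>
         f (left_point D n) = tri (f (right_point D n)) (f (over_point D n))"
    using locally_colored_iff[OF D, of f] by blast+
  have f_arc: "f b = f a" if "a \<in> points D" "equivclp (joined D) a b" for a b
    using that(2,1)
  proof (induction rule: equivclp_induct)
    case (step y z)
    then show ?case
      using f(1) joined_points[OF D] equivclp_joined_points[OF D step.hyps(1)] by metis
  qed simp
  define v where "v = (\<lambda>A\<in>diagram_arcs D. f (SOME a. a \<in> A))"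
  have v: "v (arc_of D a) = f a" if a: "a \<in> points D" for a
  proof -
    have "a \<in> arc_of D a" using a by (simp add: arc_of_def same_arc_def)
    then have some: "(SOME b. b \<in> arc_of D a) \<in> arc_of D a" by (rule someI)
    have "equivclp (joined D) a b" if "b \<in> arc_of D a" for b
      using that by (simp add: arc_of_def same_arc_def)
    then have "f (SOME b. b \<in> arc_of D a) = f a" using f_arc[OF a] some by blast
    then show ?thesis using a by (simp add: v_def D)
  qed
  have "v \<in> colorings X tri D"
    unfolding colorings_def
  proof (intro CollectI conjI ballI)
    show "v \<in> diagram_arcs D \<rightarrow>\<^sub>E X"
    proof (rule PiE_I)
      fix A assume "A \<in> diagram_arcs D"
      then show "v A \<in> X" using v fX by (auto simp: diagram_arcs_eq)
    qed (simp add: v_def)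
    fix n assume "n \<in> classical_crossings D"
    then show "v (arc_of D (left_point D n)) =
        tri (v (arc_of D (right_point D n))) (v (arc_of D (over_point D n)))"
      using f(2) v crossing_points[OF D] by simp
  qed
  moreover have "history D v = H"
  proof (rule nth_equalityI)
    show "length (history D v) = length H"
      using hist_length[OF hist] by (simp add: history_def del: upt_Suc)
    fix n assume "n < length (history D v)"
    then have n: "Suc n \<le> length D" by (simp add: history_def del: upt_Suc)
    have "([] # history D v) ! Suc n = ([] # H) ! Suc n"
      unfolding history_nth[OF D n] by (rule level[OF n]) (simp add: v)
    then show "history D v ! n = H ! n" by simp
  qed
  ultimately show ?thesis by blast
qed

lemma history_bij:
  "virtual_diagram D \<Longrightarrow> bij_betw (history D) (colorings X tri D) (histories D)"
  using history_inj history_in_histories history_surj by (fastforce simp: bij_betw_def)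

lemma apply_endo_closed:
  assumes "virtual_diagram D" "\<sigma> \<in> quandle_End X tri" "v \<in> colorings X tri D"
  shows "apply_endo D \<sigma> v \<in> colorings X tri D"
  unfolding colorings_def
proof (intro CollectI conjI ballI)
  have \<sigma>: "\<sigma> x \<in> X" if "x \<in> X" for x using assms(2) that by (auto simp: quandle_End_def)
  show "apply_endo D \<sigma> v \<in> diagram_arcs D \<rightarrow>\<^sub>E X"
    using assms(3) \<sigma> by (auto simp: apply_endo_def colorings_def)
  fix n assume n: "n \<in> classical_crossings D"
  note arcs = crossing_points[OF assms(1) n, THEN arc_of_in_arcs[OF assms(1)]]
  have "v (arc_of D (right_point D n)) \<in> X" "v (arc_of D (over_point D n)) \<in> X"
    using assms(3) arcs by (auto simp: colorings_def)
  then show "apply_endo D \<sigma> v (arc_of D (left_point D n)) =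
      tri (apply_endo D \<sigma> v (arc_of D (right_point D n))) (apply_endo D \<sigma> v (arc_of D (over_point D n)))"
    using assms(2,3) n arcs by (simp add: apply_endo_def quandle_End_def colorings_def)
qed

lemma history_apply_endo:
  assumes "virtual_diagram D"
  shows "history D (apply_endo D \<sigma> v) = map (map_level \<sigma>) (history D v)"
proof -
  have "colored_level D (apply_endo D \<sigma> v \<circ> arc_of D) n =
      map_level \<sigma> (colored_level D (v \<circ> arc_of D) n)" if "n \<le> length D" for n
    using that by (auto simp: colored_level_def map_level_def apply_endo_def assms points_def)
  then show ?thesis by (auto simp: history_def)
qed

end

section \<open>Evaluation of cocycles on coloring vectors\<close>

lemma int_multiple_simps [simp]: "int_multiple 0 a = 0" "int_multiple 1 a = a"
  "int_multiple (- 1) a = - a"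
  by (simp_all add: int_multiple_def)

text \<open>
  Passing from m = - 1 to 0 is the only step at which the two branches of the definition meet.
\<close>

lemma int_multiple_Suc: "int_multiple (m + 1) a = int_multiple m a + a"
proof (cases "0 \<le> m")
  case True
  then have "nat (m + 1) = Suc (nat m)" by simp
  then show ?thesis using True by (simp add: int_multiple_def)
next
  case False
  show ?thesis
  proof (cases "m = - 1")
    case True
    then show ?thesis by simp
  next
    case False
    then have "nat (- m) = Suc (nat (- (m + 1)))" "m + 1 < 0" using \<open>\<not> 0 \<le> m\<close> by auto
    then show ?thesis using \<open>\<not> 0 \<le> m\<close> by (simp add: int_multiple_def)
  qed
qed

lemma int_multiple_add: "int_multiple (m + n) a = int_multiple m a + int_multiple n a"
proof (induction n rule: int_induct[where k = 0])
  case (step1 n)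
  have "int_multiple (m + (n + 1)) a = int_multiple (m + n) a + a"
    using int_multiple_Suc[of "m + n" a] by (simp add: add.assoc)
  then show ?case using step1(2) int_multiple_Suc[of n a] by (simp add: add.assoc)
next
  case (step2 n)
  have "int_multiple (m + n) a = int_multiple (m + (n - 1)) a + a"
    "int_multiple n a = int_multiple (n - 1) a + a"
    using int_multiple_Suc[of "m + (n - 1)" a] int_multiple_Suc[of "n - 1" a] by simp_all
  then show ?case using step2(2) by (simp add: algebra_simps)
qed simp

lemma linear_ext_superset:
  assumes "finite K" "Poly_Mapping.keys c \<subseteq> K"
  shows "linear_ext \<phi> c = (\<Sum>p\<in>K. int_multiple (Poly_Mapping.lookup c p) (\<phi> p))"
  unfolding linear_ext_def
  by (rule sum.mono_neutral_left) (use assms in \<open>auto simp: in_keys_iff\<close>)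

lemma linear_ext_add: "linear_ext \<phi> (c + d) = linear_ext \<phi> c + linear_ext \<phi> d"
proof -
  let ?K = "Poly_Mapping.keys c \<union> Poly_Mapping.keys d"
  have "linear_ext \<phi> (c + d) =
      (\<Sum>p\<in>?K. int_multiple (Poly_Mapping.lookup c p + Poly_Mapping.lookup d p) (\<phi> p))"
    using linear_ext_superset[of ?K "c + d" \<phi>] Poly_Mapping.keys_add[of c d]
    by (simp add: lookup_add)
  also have "\<dots> = linear_ext \<phi> c + linear_ext \<phi> d"
    using linear_ext_superset[of ?K c \<phi>] linear_ext_superset[of ?K d \<phi>]
    by (simp add: int_multiple_add sum.distrib)
  finally show ?thesis .
qed

lemma linear_ext_0 [simp]: "linear_ext \<phi> 0 = 0"
  by (simp add: linear_ext_def)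

lemma linear_ext_frag_of [simp]: "linear_ext \<phi> (frag_of x) = \<phi> x"
  by (simp add: linear_ext_def)

lemma linear_ext_minus: "linear_ext \<phi> (- c) = - linear_ext \<phi> c"
  using linear_ext_add[of \<phi> c "- c"] by (simp add: eq_neg_iff_add_eq_0 add.commute)

lemma linear_ext_sum: "finite I \<Longrightarrow> linear_ext \<phi> (\<Sum>i\<in>I. c i) = (\<Sum>i\<in>I. linear_ext \<phi> (c i))"
  by (induction I rule: finite_induct) (auto simp: linear_ext_add)

lemma crossing_sign_cases: "n \<in> classical_crossings D \<Longrightarrow> crossing_sign D n \<in> {1, - 1}"
  by (auto simp: classical_crossings_def crossing_sign_def split: if_splits)

lemma finite_classical_crossings [simp]: "finite (classical_crossings D)"
  by (simp add: classical_crossings_def)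

lemma degenerate_0: "0 \<in> degenerate X"
  using generate.one[of "free_pairs X"] by (simp add: degenerate_def free_pairs_def)

lemma degenerate_add: "a \<in> degenerate X \<Longrightarrow> b \<in> degenerate X \<Longrightarrow> a + b \<in> degenerate X"
  using generate.eng[of a "free_pairs X" _ b] by (simp add: degenerate_def free_pairs_def)

lemma degenerate_induct [consumes 1, case_names zero diagonal minus add]:
  assumes "a \<in> degenerate X" "P 0" "\<And>x. x \<in> X \<Longrightarrow> P (frag_of (x, x))"
    "\<And>x. x \<in> X \<Longrightarrow> P (- frag_of (x, x))"
    "\<And>a b. a \<in> degenerate X \<Longrightarrow> b \<in> degenerate X \<Longrightarrow> P a \<Longrightarrow> P b \<Longrightarrow> P (a + b)"
  shows "P a"
  using assms(1) unfolding degenerate_def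
proof (induction rule: generate.induct)
  case (inv h)
  then obtain x where x: "x \<in> X" "h = frag_of (x, x)" by auto
  then have "inv\<^bsub>free_pairs X\<^esub> h = - h" by (simp add: free_pairs_def)
  then show ?case using x assms(4) by simp
next
  case (eng h1 h2)
  then show ?case using assms(5)[of h1 h2] by (simp add: degenerate_def free_pairs_def)
qed (use assms(2,3) in \<open>auto simp: free_pairs_def\<close>)

lemma degenerate_minus: "a \<in> degenerate X \<Longrightarrow> - a \<in> degenerate X"
proof (induction rule: degenerate_induct)
  case (diagonal x)
  have "inv\<^bsub>free_pairs X\<^esub> frag_of (x, x) \<in> degenerate X"
    unfolding degenerate_def using diagonal by (intro generate.inv) auto
  then show ?case using diagonal by (simp add: free_pairs_def)
next
  case (minus x)
  then show ?case
    unfolding degenerate_def by (auto intro: generate.incl)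
next
  case (add a b)
  then show ?case using degenerate_add by fastforce
qed (simp add: degenerate_0)

lemma degenerate_coset: "degenerate X #>\<^bsub>free_pairs X\<^esub> c = (\<lambda>d. d + c) ` degenerate X"
  by (auto simp: r_coset_def free_pairs_def)

lemma degenerate_coset_absorb:
  assumes "d \<in> degenerate X"
  shows "degenerate X #>\<^bsub>free_pairs X\<^esub> (d + c) = degenerate X #>\<^bsub>free_pairs X\<^esub> c"
proof -
  have "(\<lambda>e. e + (d + c)) ` degenerate X = (\<lambda>e. e + c) ` ((\<lambda>e. e + d) ` degenerate X)"
    by (simp add: image_image add.assoc)
  also have "(\<lambda>e. e + d) ` degenerate X = degenerate X"
  proof
    show "(\<lambda>e. e + d) ` degenerate X \<subseteq> degenerate X" using degenerate_add assms by auto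
    show "degenerate X \<subseteq> (\<lambda>e. e + d) ` degenerate X"
    proof
      fix e assume "e \<in> degenerate X"
      then have "e - d \<in> degenerate X" using degenerate_add[OF _ degenerate_minus[OF assms], of e] by simp
      then show "e \<in> (\<lambda>e. e + d) ` degenerate X" by (rule rev_image_eqI) simp
    qed
  qed
  finally show ?thesis by (simp add: degenerate_coset)
qed

lemma the_elem_constant_image:
  assumes "A \<noteq> {}" "\<And>a. a \<in> A \<Longrightarrow> f a = b"
  shows "the_elem (f ` A) = b"
proof -
  have "f ` A = {b}" using assms by auto
  then show ?thesis by simp
qed

context quandle
begin

text \<open>
  Endomorphisms map degenerate chains to degenerate ones, so their action on cosets can be computed on
  the chain of the coloring, on which it amounts to changing all colors.
\<close>

lemma endo_chain_coloring_vector: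
  assumes "virtual_diagram D" "\<sigma> \<in> quandle_End X tri"
  shows "endo_chain X \<sigma> (coloring_vector X D v) = coloring_vector X D (apply_endo D \<sigma> v)"
proof -
  let ?\<sigma> = "frag_extend (\<lambda>(x, y). frag_of (\<sigma> x, \<sigma> y))"
  have \<sigma>: "?\<sigma> d \<in> degenerate X" if "d \<in> degenerate X" for d
    using that
  proof (induction rule: degenerate_induct)
    case (diagonal x)
    then show ?case using assms(2) unfolding degenerate_def
      by (auto simp: quandle_End_def intro!: generate.incl)
  next
    case (minus x)
    have "frag_of (\<sigma> x, \<sigma> x) \<in> degenerate X" using assms(2) minus unfolding degenerate_def
      by (auto simp: quandle_End_def intro!: generate.incl)
    then show ?case using degenerate_minus by (auto simp: frag_extend_minus)
  qed (auto simp: frag_extend_add intro: degenerate_0 degenerate_add)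
  have "?\<sigma> (coloring_chain D v) = coloring_chain D (apply_endo D \<sigma> v)"
    unfolding coloring_chain_def
    by (subst frag_extend_sum)
      (auto intro!: sum.cong simp: frag_extend_cmul apply_endo_def
        crossing_points[OF assms(1)] arc_of_in_arcs[OF assms(1)])
  then have "degenerate X #>\<^bsub>free_pairs X\<^esub> ?\<sigma> (d + coloring_chain D v) =
      coloring_vector X D (apply_endo D \<sigma> v)" if "d \<in> degenerate X" for d
    using degenerate_coset_absorb[OF \<sigma>[OF that]] by (simp add: frag_extend_add coloring_vector_def)
  then show ?thesis
    unfolding endo_chain_def
    by (intro the_elem_constant_image) (use degenerate_0[of X] in \<open>auto simp: coloring_vector_def degenerate_coset\<close>)
qed

end

context quandle_cocycle
begin

text \<open>
  Cocycles vanish on degenerate chains, so the value is the same on all elements of the coset.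
\<close>

lemma evaluate_coloring_vector:
  "evaluate \<phi> (coloring_vector X D v) = linear_ext \<phi> (coloring_chain D v)"
proof -
  have "linear_ext \<phi> d = 0" if "d \<in> degenerate X" for d
    using that
    by (induction rule: degenerate_induct)
      (use cocycle in \<open>auto simp: linear_ext_add linear_ext_minus quandle_cocycles_def\<close>)
  then show ?thesis
    unfolding evaluate_def
    by (intro the_elem_constant_image)
      (use degenerate_0[of X] in \<open>auto simp: coloring_vector_def degenerate_coset linear_ext_add\<close>)
qed

lemma weight_sum: "length H = length w \<Longrightarrow>
    weight L w H = (\<Sum>n<length w. step_weight (w ! n) ((L # H) ! n))"
  by (induction L w H rule: weight.induct)
    (auto simp: sum.lessThan_Suc_shift simp del: sum.lessThan_Suc)

text \<open>
  The color to the right of the over-strand belongs to the lower or to the upper under-strand,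
  depending on the direction of the over-strand. This is the case distinction made by
  \<open>cocycle_pm\<close>.
\<close>

lemma step_weight_colored_level:
  assumes D: "virtual_diagram D" and n: "n < length D" and f: "\<And>a. a \<in> points D \<Longrightarrow> f a \<in> X"
    and loc: "locally_colored D f n"
  shows "step_weight (D ! n) (colored_level D f n) =
    (if n \<in> classical_crossings D
     then int_multiple (crossing_sign D n) (\<phi> (f (right_point D n), f (over_point D n))) else 0)"
proof (cases "\<exists>i c. D ! n = Cross i c \<and> c \<noteq> Virtual")
  case True
  then obtain i c where c: "D ! n = Cross i c" "c \<noteq> Virtual" by blast
  have n': "n \<in> classical_crossings D" using n c by (auto simp: classical_crossings_def)
  have i: "Suc i < length (level D n)" "Suc i < length (level D (Suc n))"
    using event_level(1,3)[OF D n] by (auto simp: c)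
  have "\<And>p. p \<le> Suc i \<Longrightarrow> (n, p) \<in> points D" "\<And>p. p \<le> Suc i \<Longrightarrow> (Suc n, p) \<in> points D"
    using i n by (auto simp: points_def)
  then have X: "f (n, i) \<in> X" "f (n, Suc i) \<in> X" "f (Suc n, i) \<in> X" "f (Suc n, Suc i) \<in> X"
    using f by auto
  show ?thesis
    using n' c i X loc
    by (cases c; cases "level D n ! i"; cases "level D n ! Suc i")
      (auto simp: locally_colored_def crossing_sign_def left_point_def right_point_def
        over_point_def cocycle_pm_def)
next
  case False
  then have "n \<notin> classical_crossings D" by (auto simp: classical_crossings_def)
  with False show ?thesis by (cases "(D ! n, colored_level D f n)" rule: step_weight.cases) auto
qed

lemma weight_history:
  assumes "virtual_diagram D" "v \<in> colorings X tri D"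
  shows "weight [] D (history D v) = evaluate \<phi> (coloring_vector X D v)"
proof -
  let ?f = "v \<circ> arc_of D"
  let ?t = "\<lambda>n. int_multiple (crossing_sign D n) (\<phi> (?f (right_point D n), ?f (over_point D n)))"
  have "weight [] D (history D v) = (\<Sum>n<length D. step_weight (D ! n) (([] # history D v) ! n))"
    by (rule weight_sum) (simp add: history_def del: upt_Suc)
  also have "\<dots> = (\<Sum>n<length D. if n \<in> classical_crossings D then ?t n else 0)"
  proof (rule sum.cong)
    fix n assume "n \<in> {..<length D}"
    then have n: "n < length D" by simp
    show "step_weight (D ! n) (([] # history D v) ! n) =
        (if n \<in> classical_crossings D then ?t n else 0)"
      using step_weight_colored_level[OF assms(1) n coloring_closed[OF assms(2)]
          coloring_locally_colored[OF assms n]] history_nth[OF assms(1), of n v] n by simp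
  qed simp
  also have "\<dots> = (\<Sum>n\<in>classical_crossings D. ?t n)"
    by (rule sum.mono_neutral_cong_right) (auto simp: classical_crossings_def)
  also have "\<dots> = linear_ext \<phi> (coloring_chain D v)"
    unfolding coloring_chain_def linear_ext_sum[OF finite_classical_crossings]
  proof (rule sum.cong)
    fix n assume "n \<in> classical_crossings D"
    from crossing_sign_cases[OF this] show "?t n = linear_ext \<phi> (frag_cmul (crossing_sign D n)
        (frag_of (v (arc_of D (right_point D n)), v (arc_of D (over_point D n)))))"
      by (auto simp: linear_ext_minus)
  qed simp
  also have "\<dots> = evaluate \<phi> (coloring_vector X D v)" by (simp add: evaluate_coloring_vector)
  finally show ?thesis .
qed

end

context quandle
begin

abbreviation coloring_iso where
  "coloring_iso S C D D' \<equiv> weighted_iso S C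
     (colorings X tri D) (apply_endo D) (\<lambda>\<phi> v. evaluate \<phi> (coloring_vector X D v))
     (colorings X tri D') (apply_endo D') (\<lambda>\<phi> v. evaluate \<phi> (coloring_vector X D' v))"

context
  fixes S :: "('x \<Rightarrow> 'x) set" and C :: "('x \<times> 'x \<Rightarrow> 'a::ab_group_add) set"
  assumes S: "S \<subseteq> quandle_End X tri" and C: "C \<subseteq> quandle_cocycles X tri"
begin

lemma weighted_iso_history:
  assumes "virtual_diagram D"
  shows "weighted_iso S C
     (colorings X tri D) (apply_endo D) (\<lambda>\<phi> v. evaluate \<phi> (coloring_vector X D v))
     (histories D) (\<lambda>\<sigma>. map (map_level \<sigma>)) (history_weight D) (history D)"
  unfolding weighted_iso_def
proof (intro conjI ballI)
  fix \<phi> v assume "\<phi> \<in> C" and v: "v \<in> colorings X tri D"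
  then interpret quandle_cocycle X tri \<phi> using C by unfold_locales blast
  show "history_weight D \<phi> (history D v) = evaluate \<phi> (coloring_vector X D v)"
    using weight_history assms v .
qed (use S history_bij[OF assms] apply_endo_closed[OF assms] history_apply_endo[OF assms] in auto)

lemma coloring_iso_refl:
  assumes "virtual_diagram D"
  shows "\<exists>\<beta>. coloring_iso S C D D \<beta>"
  using weighted_iso_trans[OF weighted_iso_history[OF assms]
      weighted_iso_sym[OF weighted_iso_history[OF assms]]] by blast

lemma coloring_iso_virtual_step:
  assumes "virtual_step D D'"
  shows "\<exists>\<beta>. coloring_iso S C D D' \<beta>"
proof -
  obtain u v w w' where *: "virtual_diagram D" "virtual_diagram D'"
    "D = u @ w @ v" "D' = u @ w' @ v" "move w w'"
    using assms unfolding virtual_step_def move_def by blast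
  obtain \<beta> where "weighted_iso S C
     (histories D) (\<lambda>\<sigma>. map (map_level \<sigma>)) (history_weight D)
     (histories D') (\<lambda>\<sigma>. map (map_level \<sigma>)) (history_weight D') \<beta>"
    using histories_move[OF _ _ *(5) S C] * by metis
  then show ?thesis
    using weighted_iso_trans[OF weighted_iso_history[OF *(1)]]
      weighted_iso_trans[OF _ weighted_iso_sym[OF weighted_iso_history[OF *(2)]]] by blast
qed

text \<open>
  Every classical step is also a virtual one, so the classical case is contained in the virtual case.
\<close>

lemma coloring_iso_same_link:
  assumes "same_classical_link D D' \<or> same_virtual_link D D'"
  shows "\<exists>\<beta>. coloring_iso S C D D' \<beta>"
proof -
  have classical: "virtual_step E E'" if "classical_step E E'" for E E'
    using that unfolding classical_step_def virtual_step_def classical_diagram_def by blast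
  have "equivclp virtual_step D D'"
    if "equivclp classical_step D D'"
    using that
    by (induction rule: equivclp_induct) (auto intro: equivclp_into_equivclp dest: classical)
  then have eq: "virtual_diagram D" "equivclp virtual_step D D'"
    using assms unfolding same_classical_link_def same_virtual_link_def classical_diagram_def by blast+
  from eq(2) show ?thesis
  proof (induction rule: equivclp_induct)
    case base
    show ?case using coloring_iso_refl eq(1) .
  next
    case (step E E')
    have "\<exists>\<beta>. coloring_iso S C E E' \<beta>"
      using step.hyps(2) coloring_iso_virtual_step weighted_iso_sym by blast
    then show ?case using step.IH weighted_iso_trans by blast
  qed
qed

end

end

section \<open>Isomorphic quivers\<close>

lemma cas_map:
  assumes "pre_digraph.cas (quiver X tri S D) u p w"
    and "set p \<subseteq> colorings X tri D \<times> S"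
    and "\<And>\<sigma> v. \<sigma> \<in> S \<Longrightarrow> v \<in> colorings X tri D \<Longrightarrow>
      \<beta> (apply_endo D \<sigma> v) = apply_endo D' \<sigma> (\<beta> v)"
  shows "pre_digraph.cas (quiver X tri S D') (\<beta> u) (map (map_prod \<beta> id) p) (\<beta> w)"
  using assms(1,2)
proof (induction p arbitrary: u)
  case Nil
  then show ?case by (simp add: pre_digraph.cas.simps)
next
  case (Cons e p)
  obtain \<sigma> where e: "e = (u, \<sigma>)" "u \<in> colorings X tri D" "\<sigma> \<in> S"
    and p: "pre_digraph.cas (quiver X tri S D) (apply_endo D \<sigma> u) p w"
    using Cons.prems by (cases e) (auto simp: pre_digraph.cas.simps quiver_def)
  have "pre_digraph.cas (quiver X tri S D') (\<beta> (apply_endo D \<sigma> u)) (map (map_prod \<beta> id) p) (\<beta> w)"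
    by (rule Cons.IH[OF p]) (use Cons.prems(2) in auto)
  then show ?case using assms(3) e by (simp add: pre_digraph.cas.simps quiver_def id_def)
qed

context quandle
begin

context
  fixes S C D D' \<beta> \<gamma>
  assumes iso: "coloring_iso S C D D' \<beta>"
    and S: "S \<subseteq> quandle_End X tri" and D: "virtual_diagram D" "virtual_diagram D'"
  defines "\<gamma> \<equiv> map_prod \<beta> (id :: ('x \<Rightarrow> 'x) \<Rightarrow> _)"
begin

lemma arcs_bij: "bij_betw \<gamma> (arcs (quiver X tri S D)) (arcs (quiver X tri S D'))"
  using iso map_prod_surj_on[of \<beta> "colorings X tri D" "colorings X tri D'" id S S]
  by (auto simp: weighted_iso_def quiver_def \<gamma>_def bij_betw_def inj_on_def)

text \<open>
  The weight of an edge involves only the values of cocycles on its tail and, by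
  \<open>endo_chain_coloring_vector\<close>, on its head.
\<close>

lemma edge_weight_iso:
  assumes "e \<in> arcs (quiver X tri S D)"
  shows "edge_weight X C D' (\<gamma> e) = edge_weight X C D e"
proof -
  obtain v \<sigma> where e: "e = (v, \<sigma>)" "v \<in> colorings X tri D" "\<sigma> \<in> S"
    using assms by (auto simp: quiver_def)
  then have "apply_endo D \<sigma> v \<in> colorings X tri D" "\<beta> (apply_endo D \<sigma> v) = apply_endo D' \<sigma> (\<beta> v)"
    "\<sigma> \<in> quandle_End X tri"
    using iso S by (auto simp: weighted_iso_def)
  moreover have "evaluate \<phi> (coloring_vector X D' (\<beta> u)) = evaluate \<phi> (coloring_vector X D u)"
    if "u \<in> colorings X tri D" "\<phi> \<in> C" for u \<phi>
    using iso that by (auto simp: weighted_iso_def)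
  ultimately show ?thesis
    using e(2) by (auto simp: edge_weight_def e(1) \<gamma>_def endo_chain_coloring_vector D
        simp flip: \<open>\<beta> (apply_endo D \<sigma> v) = apply_endo D' \<sigma> (\<beta> v)\<close> intro!: ext sum.cong)
qed

lemma nonrepeating_map:
  assumes "p \<in> nonrepeating_paths (quiver X tri S D)"
  shows "map \<gamma> p \<in> nonrepeating_paths (quiver X tri S D')"
proof -
  let ?G = "quiver X tri S D" and ?G' = "quiver X tri S D'"
  obtain u w where p: "p \<noteq> []" "u \<in> verts ?G" "set p \<subseteq> arcs ?G" "pre_digraph.cas ?G u p w" "distinct p"
    using assms by (auto simp: nonrepeating_paths_def pre_digraph.trail_def pre_digraph.awalk_def)
  have "\<beta> u \<in> verts ?G'"
    using p(2) iso by (auto simp: quiver_def weighted_iso_def bij_betw_def)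
  moreover have "set (map \<gamma> p) \<subseteq> arcs ?G'" using p(3) arcs_bij by (auto simp: bij_betw_def)
  moreover have "distinct (map \<gamma> p)"
    using p(3,5) arcs_bij by (auto simp: distinct_map bij_betw_def intro: inj_on_subset)
  moreover have "pre_digraph.cas ?G' (\<beta> u) (map \<gamma> p) (\<beta> w)"
    unfolding \<gamma>_def by (rule cas_map[OF p(4)]) (use p(3) iso in \<open>auto simp: quiver_def weighted_iso_def\<close>)
  ultimately show ?thesis
    using p(1) by (auto simp: nonrepeating_paths_def pre_digraph.trail_def pre_digraph.awalk_def)
qed

lemma path_weight_iso:
  assumes "p \<in> nonrepeating_paths (quiver X tri S D)"
  shows "path_weight X C D' (map \<gamma> p) = path_weight X C D p"
proof -
  have "set p \<subseteq> arcs (quiver X tri S D)"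
    using assms by (auto simp: nonrepeating_paths_def pre_digraph.trail_def pre_digraph.awalk_def)
  then show ?thesis
    unfolding path_weight_def fold_map comp_def
    by (intro fold_cong) (auto simp: edge_weight_iso)
qed

end

context
  fixes S C D D' \<beta>
  assumes iso: "coloring_iso S C D D' \<beta>"
    and S: "S \<subseteq> quandle_End X tri" and D: "virtual_diagram D" "virtual_diagram D'"
begin

lemma map_inverse:
  assumes "p \<in> nonrepeating_paths (quiver X tri S D)"
  shows "map (map_prod (inv_into (colorings X tri D) \<beta>) id) (map (map_prod \<beta> id) p) = p"
proof -
  have "set p \<subseteq> colorings X tri D \<times> S"
    using assms by (auto simp: nonrepeating_paths_def pre_digraph.trail_def pre_digraph.awalk_def quiver_def)
  moreover have "inj_on \<beta> (colorings X tri D)" using iso by (auto simp: weighted_iso_def bij_betw_def)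
  ultimately show ?thesis by (auto simp: map_idI comp_def intro!: map_idI)
qed

text \<open>
  A longer nonrepeating path in the second quiver would be mapped back to one that extends p.
\<close>

lemma maximal_map:
  assumes "p \<in> maximal_paths (quiver X tri S D)"
  shows "map (map_prod \<beta> id) p \<in> maximal_paths (quiver X tri S D')"
proof -
  let ?\<gamma> = "map_prod \<beta> id" and ?\<delta> = "map_prod (inv_into (colorings X tri D) \<beta>) id"
  have p: "p \<in> nonrepeating_paths (quiver X tri S D)" using assms by (simp add: maximal_paths_def)
  have "\<not> strict_sublist (map ?\<gamma> p) q" if q: "q \<in> nonrepeating_paths (quiver X tri S D')" for q
  proof
    assume s: "strict_sublist (map ?\<gamma> p) q"
    then have "sublist (map ?\<gamma> p) q" "length p < length q"
      by (auto simp: strict_sublist_def sublist_def)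
    then have "sublist p (map ?\<delta> q)" "p \<noteq> map ?\<delta> q"
      using map_mono_sublist[of "map ?\<gamma> p" q ?\<delta>] map_inverse[OF p] by auto
    moreover have "map ?\<delta> q \<in> nonrepeating_paths (quiver X tri S D)"
      using nonrepeating_map[OF weighted_iso_sym[OF iso] S D(2,1) q] .
    ultimately show False using assms by (auto simp: maximal_paths_def strict_sublist_def)
  qed
  then show ?thesis using nonrepeating_map[OF iso S D p] by (auto simp: maximal_paths_def)
qed

end

lemma maximal_bij:
  assumes iso: "coloring_iso S C D D' \<beta>"
    and S: "S \<subseteq> quandle_End X tri" and D: "virtual_diagram D" "virtual_diagram D'"
  shows "bij_betw (map (map_prod \<beta> id)) (maximal_paths (quiver X tri S D))
    (maximal_paths (quiver X tri S D'))"
proof (rule bij_betw_byWitness)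
  let ?V = "colorings X tri D" and ?V' = "colorings X tri D'"
  let ?\<delta> = "inv_into ?V \<beta>"
  note sym = weighted_iso_sym[OF iso]
  have sub: "maximal_paths G \<subseteq> nonrepeating_paths G" for G :: "('v, 'e) pre_digraph"
    by (auto simp: maximal_paths_def)
  show "\<forall>p\<in>maximal_paths (quiver X tri S D). map (map_prod ?\<delta> id) (map (map_prod \<beta> id) p) = p"
    using map_inverse[OF iso S D] sub by blast
  have "\<beta> (?\<delta> v) = v" if "v \<in> ?V'" for v
    using iso that by (auto simp: weighted_iso_def bij_betw_inv_into_right)
  then show "\<forall>q\<in>maximal_paths (quiver X tri S D'). map (map_prod \<beta> id) (map (map_prod ?\<delta> id) q) = q"
    by (fastforce simp: maximal_paths_def nonrepeating_paths_def pre_digraph.trail_def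
        pre_digraph.awalk_def quiver_def intro!: map_idI)
  show "map (map_prod \<beta> id) ` maximal_paths (quiver X tri S D) \<subseteq> maximal_paths (quiver X tri S D')"
    using maximal_map[OF iso S D] by blast
  show "map (map_prod ?\<delta> id) ` maximal_paths (quiver X tri S D') \<subseteq> maximal_paths (quiver X tri S D)"
    using maximal_map[OF sym S D(2,1)] by blast
qed

end

theorem proposition4:
  fixes X :: "'x set" and tri :: "'x \<Rightarrow> 'x \<Rightarrow> 'x"
    and C :: "('x \<times> 'x \<Rightarrow> 'a::ab_group_add) set"
    and S :: "('x \<Rightarrow> 'x) set"
    and D D' :: "event list"
  assumes "quandle X tri" and "finite X"
    and "finite C" and "C \<subseteq> quandle_cocycles X tri"
    and "S \<subseteq> quandle_End X tri"
    and "same_classical_link D D' \<or> same_virtual_link D D'"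
  shows
    "(edge_characteristic_polynomial X tri C S D :: 'k::comm_ring_1 poly) =
       edge_characteristic_polynomial X tri C S D' \<and>
     (path_characteristic_polynomial X tri C S D :: 'k poly poly) =
       path_characteristic_polynomial X tri C S D' \<and>
     (edge_matrix_polynomial X tri C S D :: 'a \<times> 'a \<Rightarrow>\<^sub>0 'k) =
       edge_matrix_polynomial X tri C S D' \<and>
     (path_matrix_polynomial X tri C S D :: ('a \<times> 'a \<Rightarrow>\<^sub>0 'k) poly) =
       path_matrix_polynomial X tri C S D'"
proof -
  interpret quandle X tri by fact
  obtain \<beta> where iso: "coloring_iso S C D D' \<beta>"
    using coloring_iso_same_link[OF assms(5,4,6)] by blast
  have D: "virtual_diagram D" "virtual_diagram D'"
    using assms(6) by (auto simp: same_classical_link_def same_virtual_link_def classical_diagram_def)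
  let ?G = "quiver X tri S D" and ?G' = "quiver X tri S D'" and ?\<gamma> = "map_prod \<beta> id"
  have edges: "(\<Sum>e\<in>arcs ?G. F (edge_weight X C D e)) = (\<Sum>e\<in>arcs ?G'. F (edge_weight X C D' e))"
    for F :: "(('a, 'k) free_module \<Rightarrow> ('a, 'k) free_module) \<Rightarrow> 'm::comm_monoid_add"
    unfolding sum.reindex_bij_betw[OF arcs_bij[OF iso assms(5) D], symmetric]
    by (intro sum.cong) (simp_all add: edge_weight_iso[OF iso assms(5) D])
  have paths: "(\<Sum>p\<in>maximal_paths ?G. F (path_weight X C D p) (length p)) =
      (\<Sum>p\<in>maximal_paths ?G'. F (path_weight X C D' p) (length p))"
    for F :: "(('a, 'k) free_module \<Rightarrow> ('a, 'k) free_module) \<Rightarrow> nat \<Rightarrow> 'm::comm_monoid_add"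
    unfolding sum.reindex_bij_betw[OF maximal_bij[OF iso assms(5) D], symmetric]
    by (intro sum.cong) (simp_all add: path_weight_iso[OF iso assms(5) D] maximal_paths_def)
  show ?thesis
    unfolding edge_characteristic_polynomial_def path_characteristic_polynomial_def
      edge_matrix_polynomial_def path_matrix_polynomial_def
    by (intro conjI edges paths[of "\<lambda>M. Polynomial.monom (charpoly_of M)"]
        paths[of "\<lambda>M. Polynomial.monom (matpoly_of M)"])
qed

end
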